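(* Let $r$ be a real number and let $G$ be a graph with at least one edge such that $\nabla_{1}(G)\leq r$. Then $$\mathrm{cw}(G)< 2\cdot 4^{r}\, \mathrm{rw}(G)\qquad\text{and}\qquad \mathrm{tw}(G)+1< 12\, r\, 4^{r}\, \mathrm{rw}(G).$$
   Context: All graphs are finite, simple and undirected. $\mathrm{tw}(G)$ denotes the tree-width of $G$ (minimum over tree decompositions of the maximum bag size minus one). The greatest reduced average degree with rank $1$ of $G$ is $\nabla_1(G)=\max |E(H)|/|V(H)|$, where the maximum is taken over all (nonempty) minors $H$ of $G$ obtained by removing some vertices, contracting a set of pairwise vertex-disjoint (connected) subgraphs of radius at most $1$, each to a single vertex, and then deleting any number of edges. Rank-width. For $X\subseteq V(G)$, the cut-rank $\rho_G(X)$ is the rank over $\mathrm{GF}(2)$ of the $X\times (V(G)\setminus X)$ matrix whose $(i,j)$ entry is $1$ iff $i$ and $j$ are adjacent in $G$; $\rho_G(\emptyset)=\rho_G(V(G))=0$. A tree is ternary if all its vertices have degree $1$ or $3$. A rank-decomposition of $G$ is a pair $(T,\mu)$ of a ternary tree $T$ and a bijection $\mu$ from $V(G)$ to the set $L(T)$ of leaves of $T$. Each edge $e$ of $T$ defines a partition $(X_e,Y_e)$ of $L(T)$ (leaves of the two components of $T\setminus e$); the width of $e$ is $\rho_G(\mu^{-1}(X_e))$, and the width of $(T,\mu)$ is the maximum width of its edges. The rank-width $\mathrm{rw}(G)$ is the minimum width of all rank-decompositions of $G$ (and is $0$ if $|V(G)|\le 1$). Clique-width. A $k$-graph is a pair $(G,\mathrm{lab})$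 with $\mathrm{lab}:V(G)\to\{1,\dots,k\}$. $k$-expressions are built from: $\cdot_i$ (a single vertex with label $i$); $\rho_{i\to j}$ with $i\ne j$ (relabel every vertex of label $i$ to $j$); $\eta_{i,j}$ with $i\neq j$ (add all edges between vertices of label $i$ and vertices of label $j$); $\oplus$ (disjoint union of two $k$-graphs). The clique-width $\mathrm{cw}(G)$ is the minimum $k$ such that some $k$-expression has value $(G,\mathrm{lab})$ for some labeling $\mathrm{lab}$. *)

theory Defs
  imports Complex_Main "HOL-Library.Z2" "HOL-Library.Function_Algebras"
begin

section \<open>Finite simple undirected graphs\<close>

record 'a graph =
  verts :: "'a set"
  edges :: "'a set set"

definition simple_graph :: "'a graph \<Rightarrow> bool" where
  "simple_graph G \<longleftrightarrow> finite (verts G) \<and> (\<forall>e\<in>edges G. e \<subseteq> verts G \<and> card e = 2)"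

definition subgraph :: "'a graph \<Rightarrow> 'a graph \<Rightarrow> bool" where
  "subgraph H G \<longleftrightarrow> simple_graph H \<and> verts H \<subseteq> verts G \<and> edges H \<subseteq> edges G"

definition induced :: "'a graph \<Rightarrow> 'a set \<Rightarrow> 'a graph" where
  "induced G W = \<lparr>verts = verts G \<inter> W, edges = {e \<in> edges G. e \<subseteq> W}\<rparr>"

definition remove_edge :: "'a graph \<Rightarrow> 'a set \<Rightarrow> 'a graph" where
  "remove_edge G e = \<lparr>verts = verts G, edges = edges G - {e}\<rparr>"

definition degree :: "'a graph \<Rightarrow> 'a \<Rightarrow> nat" where
  "degree G v = card {e \<in> edges G. v \<in> e}"

text \<open>A walk is given by its list of vertices, so it has \<open>length xs - 1\<close> edges.\<close>

definition walk :: "'a graph \<Rightarrow> 'a \<Rightarrow> 'a list \<Rightarrow> 'a \<Rightarrow> bool" where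
  "walk G u xs v \<longleftrightarrow> xs \<noteq> [] \<and> hd xs = u \<and> last xs = v \<and> set xs \<subseteq> verts G \<and>
     successively (\<lambda>x y. {x, y} \<in> edges G) xs"

definition connected_graph :: "'a graph \<Rightarrow> bool" where
  "connected_graph G \<longleftrightarrow> verts G \<noteq> {} \<and> (\<forall>u\<in>verts G. \<forall>v\<in>verts G. \<exists>xs. walk G u xs v)"

definition components :: "'a graph \<Rightarrow> 'a set set" where
  "components G = (\<lambda>u. {v. \<exists>xs. walk G u xs v}) ` verts G"

definition is_cycle :: "'a graph \<Rightarrow> 'a list \<Rightarrow> bool" where
  "is_cycle G xs \<longleftrightarrow> length xs \<ge> 3 \<and> distinct xs \<and> walk G (hd xs) xs (last xs) \<and>
     {last xs, hd xs} \<in> edges G"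

definition is_tree :: "'a graph \<Rightarrow> bool" where
  "is_tree T \<longleftrightarrow> simple_graph T \<and> connected_graph T \<and> (\<nexists>xs. is_cycle T xs)"


section \<open>Tree-width\<close>

text \<open>Every finite tree is isomorphic to one whose nodes are natural numbers, so here and in
  the definition of rank-width it suffices to let \<open>T\<close> range over trees on subsets of \<open>\<nat>\<close>.\<close>

definition tree_decomposition :: "'a graph \<Rightarrow> nat graph \<Rightarrow> (nat \<Rightarrow> 'a set) \<Rightarrow> bool" where
  "tree_decomposition G T bag \<longleftrightarrow> is_tree T \<and>
     (\<Union>t\<in>verts T. bag t) = verts G \<and>
     (\<forall>e\<in>edges G. \<exists>t\<in>verts T. e \<subseteq> bag t) \<and>
     (\<forall>v\<in>verts G. connected_graph (induced T {t. v \<in> bag t}))"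

text \<open>The truncated subtraction only matters for the graph without vertices.\<close>

definition td_width :: "nat graph \<Rightarrow> (nat \<Rightarrow> 'a set) \<Rightarrow> nat" where
  "td_width T bag = Max ((\<lambda>t. card (bag t)) ` verts T) - 1"

definition treewidth :: "'a graph \<Rightarrow> nat" where
  "treewidth G = (LEAST w. \<exists>T bag. tree_decomposition G T bag \<and> td_width T bag = w)"


section \<open>Greatest reduced average degree\<close>

text \<open>Having radius at most \<open>d\<close> includes being nonempty and connected.\<close>

definition radius_at_most :: "nat \<Rightarrow> 'a graph \<Rightarrow> bool" where
  "radius_at_most d H \<longleftrightarrow>
     (\<exists>c\<in>verts H. \<forall>v\<in>verts H. \<exists>xs. walk H c xs v \<and> length xs - 1 \<le> d)"

text \<open>The graph obtained by contracting each subgraph in \<open>S\<close> to a vertex. A vertex of the new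
  graph is represented by the set of vertices of \<open>G\<close> that were merged into it; loops and parallel
  edges are suppressed.\<close>

definition contract :: "'a graph \<Rightarrow> 'a graph set \<Rightarrow> 'a set graph" where
  "contract G S =
     (let P = verts ` S \<union> {{v} | v. v \<in> verts G \<and> (\<forall>B\<in>S. v \<notin> verts B)}
      in \<lparr>verts = P,
          edges = {{A, B} | A B. A \<in> P \<and> B \<in> P \<and> A \<noteq> B \<and> (\<exists>a\<in>A. \<exists>b\<in>B. {a, b} \<in> edges G)}\<rparr>)"

definition shallow_minor :: "nat \<Rightarrow> 'a set graph \<Rightarrow> 'a graph \<Rightarrow> bool" where
  "shallow_minor d H G \<longleftrightarrow>
     (\<exists>W S. W \<subseteq> verts G \<and>
        (\<forall>B\<in>S. subgraph B (induced G W) \<and> radius_at_most d B) \<and>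
        pairwise (\<lambda>B C. verts B \<inter> verts C = {}) S \<and>
        verts H = verts (contract (induced G W) S) \<and>
        edges H \<subseteq> edges (contract (induced G W) S))"

definition nabla :: "nat \<Rightarrow> 'a graph \<Rightarrow> real" where
  "nabla d G =
     Max {real (card (edges H)) / real (card (verts H)) | H. shallow_minor d H G \<and> verts H \<noteq> {}}"


section \<open>Rank-width\<close>

text \<open>The type \<^typ>\<open>bit\<close> is the field GF(2).\<close>

definition gf2_scale :: "bit \<Rightarrow> ('a \<Rightarrow> bit) \<Rightarrow> 'a \<Rightarrow> bit" where
  "gf2_scale c f = (\<lambda>x. c * f x)"

global_interpretation gf2: vector_space gf2_scale
  by unfold_locales (auto simp: gf2_scale_def fun_eq_iff algebra_simps)

text \<open>The rank is the dimension of the row space. The row of the matrix with index \<open>i\<close> is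
  extended by zeros outside the index set \<open>verts G - X\<close> of the columns.\<close>

definition cut_row :: "'a graph \<Rightarrow> 'a set \<Rightarrow> 'a \<Rightarrow> 'a \<Rightarrow> bit" where
  "cut_row G X i = (\<lambda>j. if j \<in> verts G - X \<and> {i, j} \<in> edges G then 1 else 0)"

definition cut_rank :: "'a graph \<Rightarrow> 'a set \<Rightarrow> nat" where
  "cut_rank G X = gf2.dim (cut_row G X ` X)"

definition ternary_tree :: "'a graph \<Rightarrow> bool" where
  "ternary_tree T \<longleftrightarrow> is_tree T \<and> (\<forall>t\<in>verts T. degree T t = 1 \<or> degree T t = 3)"

definition leaves :: "'a graph \<Rightarrow> 'a set" where
  "leaves T = {t \<in> verts T. degree T t = 1}"

definition rank_decomposition :: "'a graph \<Rightarrow> nat graph \<Rightarrow> ('a \<Rightarrow> nat) \<Rightarrow> bool" where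
  "rank_decomposition G T \<mu> \<longleftrightarrow> ternary_tree T \<and> bij_betw \<mu> (verts G) (leaves T)"

text \<open>Both sides of every tree edge are taken into account; as the cut-rank is symmetric,
  they contribute the same value.\<close>

definition rd_width :: "'a graph \<Rightarrow> nat graph \<Rightarrow> ('a \<Rightarrow> nat) \<Rightarrow> nat" where
  "rd_width G T \<mu> =
     Max {cut_rank G {v \<in> verts G. \<mu> v \<in> C} | e C. e \<in> edges T \<and> C \<in> components (remove_edge T e)}"

definition rankwidth :: "'a graph \<Rightarrow> nat" where
  "rankwidth G =
     (if card (verts G) \<le> 1 then 0
      else LEAST w. \<exists>T \<mu>. rank_decomposition G T \<mu> \<and> rd_width G T \<mu> = w)"


section \<open>Clique-width\<close>

text \<open>The operation creating a single labelled vertex also carries the name of the vertex. This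
  way the value of an expression is a concrete graph rather than an isomorphism class, provided
  that the operands of each disjoint union have no vertex names in common.\<close>

datatype 'a cw_expr =
    Single 'a nat
  | Relabel nat nat "'a cw_expr"
  | Join nat nat "'a cw_expr"
  | Disj_Union "'a cw_expr" "'a cw_expr"

primrec expr_verts :: "'a cw_expr \<Rightarrow> 'a set" where
  "expr_verts (Single v i) = {v}"
| "expr_verts (Relabel i j t) = expr_verts t"
| "expr_verts (Join i j t) = expr_verts t"
| "expr_verts (Disj_Union s t) = expr_verts s \<union> expr_verts t"

text \<open>The labelling is only meaningful on \<open>expr_verts\<close>.\<close>

primrec expr_lab :: "'a cw_expr \<Rightarrow> 'a \<Rightarrow> nat" where
  "expr_lab (Single v i) = (\<lambda>_. i)"
| "expr_lab (Relabel i j t) = (\<lambda>v. if expr_lab t v = i then j else expr_lab t v)"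
| "expr_lab (Join i j t) = expr_lab t"
| "expr_lab (Disj_Union s t) = (\<lambda>v. if v \<in> expr_verts s then expr_lab s v else expr_lab t v)"

primrec expr_edges :: "'a cw_expr \<Rightarrow> 'a set set" where
  "expr_edges (Single v i) = {}"
| "expr_edges (Relabel i j t) = expr_edges t"
| "expr_edges (Join i j t) = expr_edges t \<union>
     {{u, v} | u v. u \<in> expr_verts t \<and> v \<in> expr_verts t \<and> expr_lab t u = i \<and> expr_lab t v = j}"
| "expr_edges (Disj_Union s t) = expr_edges s \<union> expr_edges t"

primrec k_expr :: "nat \<Rightarrow> 'a cw_expr \<Rightarrow> bool" where
  "k_expr k (Single v i) \<longleftrightarrow> i \<in> {1..k}"
| "k_expr k (Relabel i j t) \<longleftrightarrow> i \<in> {1..k} \<and> j \<in> {1..k} \<and> i \<noteq> j \<and> k_expr k t"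
| "k_expr k (Join i j t) \<longleftrightarrow> i \<in> {1..k} \<and> j \<in> {1..k} \<and> i \<noteq> j \<and> k_expr k t"
| "k_expr k (Disj_Union s t) \<longleftrightarrow> k_expr k s \<and> k_expr k t \<and> expr_verts s \<inter> expr_verts t = {}"

definition cliquewidth :: "'a graph \<Rightarrow> nat" where
  "cliquewidth G =
     (LEAST k. \<exists>t. k_expr k t \<and> expr_verts t = verts G \<and> expr_edges t = edges G)"

end

theory Submission
  imports Defs
begin

text \<open>Write \<open>k\<close> for the rank-width of \<open>G\<close>. The bound on \<open>nabla 1 G\<close> controls how many different
neighbourhoods can be seen across a cut of rank at most \<open>k\<close>; this makes every cut of an optimal
rank-decomposition simple enough for it to be turned into a clique-width expression, and into a
tree decomposition.

\<^emph>\<open>Few neighbourhoods across a cut.\<close> If \<open>X\<close> has cut-rank at most \<open>k\<close>, then some set \<open>B\<close> of at most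
\<open>k\<close> columns already separates all rows (\<open>separating_columns\<close>), so it suffices to count traces of
neighbourhoods on \<open>B\<close>. Choose one vertex for each nonempty trace and run through the traces by
increasing size. As long as a trace contains two members of \<open>B\<close> that are not yet joined, contract
its vertex into one of them, which joins the two. This uses up a distinct vertex for each edge of
a graph on \<open>B\<close> that is a minor of radius 1, and the traces left over are cliques of that graph.
Pairs are treated before larger sets, so none of the left-over cliques is an edge. Hence the
number of nonempty traces is at most the number of nonempty cliques of a graph on \<open>B\<close> all of whose
subgraphs have average degree at most \<open>2 * r\<close>. Removing vertices of minimum degree one at a time
shows that there are at most \<open>2 powr (2 * r) * (k - 1) + 1\<close> such cliques (\<open>card_nbs_le\<close>).
Let \<open>m\<close> be the integer part of this number. An edge of \<open>G\<close> forces \<open>r \<ge> 1/2\<close> and \<open>k \<ge> 1\<close>, and then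
\<open>2 * m + 1 < 2 * 4 powr r * k\<close>.

\<^emph>\<open>Clique-width.\<close> Cutting an edge of the decomposition tree and descending from it describes the
vertex set as built from singletons by binary disjoint unions of sets of cut-rank at most \<open>k\<close>
(\<open>branching_of_rankwidth\<close>). An expression for such a set needs \<open>m\<close> labels for the vertices that
have neighbours outside, one per neighbourhood, and one label for all others. Two such expressions
with disjoint ranges of \<open>m\<close> labels and a common last label can be joined, so \<open>2 * m + 1\<close> labels
suffice (\<open>expression_of_branching\<close>).

\<^emph>\<open>Tree-width.\<close> Let \<open>d\<close> be the integer part of \<open>2 * r\<close>. A complete bipartite graph with \<open>d + 1\<close>
vertices on each side has ratio \<open>(d + 1) / 2 > r\<close> of edges to vertices, so it does not occur in
\<open>G\<close>. For a set of the branching, consider a class of vertices with the same neighbourhood outside: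
either the class or that neighbourhood has at most \<open>d\<close> elements. Taking the class whenever it is
small, and the neighbourhood otherwise, gives a set of at most \<open>m * d\<close> vertices that covers all
edges leaving the set. The union of these covers for a set and its two parts serves as a bag, which
yields bags of size at most \<open>3 * m * d\<close> (\<open>treewidth_le_of_branching\<close>), and
\<open>3 * m * d \<le> 6 * r * m < 12 * r * 4 powr r * k\<close>.\<close>

section \<open>Walks, bridges and trees\<close>

definition adj :: "'a graph \<Rightarrow> ('a \<times> 'a) set" where
  "adj G = {(x, y). x \<in> verts G \<and> y \<in> verts G \<and> {x, y} \<in> edges G}"

lemma adj_sym: "(x, y) \<in> adj G \<Longrightarrow> (y, x) \<in> adj G"
  by (auto simp: adj_def insert_commute)

lemma rtrancl_adj_verts: "(x, y) \<in> (adj G)\<^sup>* \<Longrightarrow> x \<in> verts G \<Longrightarrow> y \<in> verts G"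
  by (induction rule: rtrancl_induct) (auto simp: adj_def)

lemma walk_imp_rtrancl:
  "walk G u xs v \<Longrightarrow> u \<in> verts G \<and> v \<in> verts G \<and> (u, v) \<in> (adj G)\<^sup>*"
proof (induction xs arbitrary: u)
  case Nil
  then show ?case by (simp add: walk_def)
next
  case (Cons x xs)
  show ?case
  proof (cases "xs = []")
    case True
    then show ?thesis using Cons.prems by (auto simp: walk_def)
  next
    case False
    have w: "walk G (hd xs) xs v" and s: "(u, hd xs) \<in> adj G" and u: "u \<in> verts G"
      using Cons.prems False by (auto simp: walk_def adj_def successively_Cons)
    show ?thesis using Cons.IH[OF w] s u by (meson converse_rtrancl_into_rtrancl)
  qed
qed

lemma rtrancl_imp_distinct_walk:
  "(u, v) \<in> (adj G)\<^sup>* \<Longrightarrow> v \<in> verts G \<Longrightarrow> \<exists>xs. walk G u xs v \<and> distinct xs"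
proof (induction rule: converse_rtrancl_induct)
  case base
  then have "walk G v [v] v \<and> distinct [v]" by (simp add: walk_def)
  then show ?case by blast
next
  case (step y z)
  then obtain xs where xs: "walk G z xs v" "distinct xs" by blast
  show ?case
  proof (cases "y \<in> set xs")
    case True
    then obtain as bs where "xs = as @ y # bs" by (meson split_list)
    then have "walk G y (y # bs) v \<and> distinct (y # bs)"
      using xs by (auto simp: walk_def successively_append_iff)
    then show ?thesis by blast
  next
    case False
    then have "walk G y (y # xs) v \<and> distinct (y # xs)"
      using xs step.hyps by (auto simp: walk_def adj_def successively_Cons)
    then show ?thesis by blast
  qed
qed

lemma ex_walk_iff: "(\<exists>xs. walk G u xs v) \<longleftrightarrow> u \<in> verts G \<and> (u, v) \<in> (adj G)\<^sup>*"
  by (meson rtrancl_imp_distinct_walk walk_imp_rtrancl rtrancl_adj_verts)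

lemma connected_graph_iff:
  "connected_graph G \<longleftrightarrow> verts G \<noteq> {} \<and> (\<forall>u\<in>verts G. \<forall>v\<in>verts G. (u, v) \<in> (adj G)\<^sup>*)"
  unfolding connected_graph_def ex_walk_iff by blast

lemma simple_graph_edge:
  assumes "simple_graph G" "{x, y} \<in> edges G"
  shows "x \<noteq> y" "x \<in> verts G" "y \<in> verts G"
  using assms unfolding simple_graph_def by (auto dest!: bspec)

lemma simple_graph_finite_edges: "simple_graph G \<Longrightarrow> finite (edges G)"
  by (rule finite_subset[of _ "Pow (verts G)"]) (auto simp: simple_graph_def)

text \<open>A cycle is an edge together with a second way of getting from one of its ends to the other.
Stating acyclicity through bridges replaces lists of vertices by reachability, for which closure
arguments are available.\<close>

lemma acyclic_iff_bridges:
  assumes T: "simple_graph T"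
  shows "(\<nexists>xs. is_cycle T xs) \<longleftrightarrow>
    (\<forall>x y. {x, y} \<in> edges T \<longrightarrow> (x, y) \<notin> (adj (remove_edge T {x, y}))\<^sup>*)"
proof (intro iffI allI impI notI)
  fix x y
  assume nc: "\<nexists>xs. is_cycle T xs" and e: "{x, y} \<in> edges T"
    and r: "(x, y) \<in> (adj (remove_edge T {x, y}))\<^sup>*"
  have xy: "x \<noteq> y" "y \<in> verts T" using simple_graph_edge[OF T e] by auto
  then obtain xs where xs: "walk (remove_edge T {x, y}) x xs y" "distinct xs"
    using rtrancl_imp_distinct_walk[OF r] by (auto simp: remove_edge_def)
  have len: "length xs \<ge> 3"
  proof (rule ccontr)
    assume "\<not> ?thesis"
    then consider "xs = []" | a where "xs = [a]" | a b where "xs = [a, b]"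
      by (cases xs; cases "tl xs"; cases "tl (tl xs)") auto
    then show False using xs xy by cases (auto simp: walk_def remove_edge_def)
  qed
  have "walk T x xs y"
    using xs(1) unfolding walk_def remove_edge_def by (auto elim!: successively_mono)
  then have "is_cycle T xs"
    using len xs(2) e by (auto simp: is_cycle_def walk_def insert_commute)
  then show False using nc by blast
next
  assume br: "\<forall>x y. {x, y} \<in> edges T \<longrightarrow> (x, y) \<notin> (adj (remove_edge T {x, y}))\<^sup>*"
    and "\<exists>xs. is_cycle T xs"
  then obtain xs where len: "length xs \<ge> 3" and dist: "distinct xs"
    and w: "walk T (hd xs) xs (last xs)" and e: "{last xs, hd xs} \<in> edges T"
    by (auto simp: is_cycle_def)
  have ne: "xs \<noteq> []" using len by auto
  have "{xs ! i, xs ! Suc i} \<noteq> {hd xs, last xs}" if "Suc i < length xs" for i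
  proof
    assume "{xs ! i, xs ! Suc i} = {hd xs, last xs}"
    then have "(xs ! i = xs ! 0 \<and> xs ! Suc i = xs ! (length xs - 1)) \<or>
        (xs ! i = xs ! (length xs - 1) \<and> xs ! Suc i = xs ! 0)"
      using ne by (auto simp: hd_conv_nth last_conv_nth doubleton_eq_iff)
    then show False
    proof
      assume "xs ! i = xs ! 0 \<and> xs ! Suc i = xs ! (length xs - 1)"
      then have "i = 0" "Suc i = length xs - 1"
        using that ne nth_eq_iff_index_eq[OF dist] by auto
      then show False using len by simp
    next
      assume "xs ! i = xs ! (length xs - 1) \<and> xs ! Suc i = xs ! 0"
      then have "Suc i = 0" using that ne nth_eq_iff_index_eq[OF dist] by auto
      then show False by simp
    qed
  qed
  then have "walk (remove_edge T {hd xs, last xs}) (hd xs) xs (last xs)"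
    using w by (auto simp: walk_def remove_edge_def successively_conv_nth)
  then show False using br e walk_imp_rtrancl by (metis insert_commute)
qed

lemma is_tree_iff:
  "is_tree T \<longleftrightarrow> simple_graph T \<and> connected_graph T \<and>
    (\<forall>x y. {x, y} \<in> edges T \<longrightarrow> (x, y) \<notin> (adj (remove_edge T {x, y}))\<^sup>*)"
  unfolding is_tree_def using acyclic_iff_bridges by blast

text \<open>The set \<open>U\<close> may be empty and need not lie in \<open>T\<close>: for tree decompositions \<open>U\<close> is the set of
nodes whose bag contains a given vertex, and only its part inside the tree is relevant.\<close>

definition connected_on :: "'a graph \<Rightarrow> 'a set \<Rightarrow> bool" where
  "connected_on T U \<longleftrightarrow>
    (\<forall>u \<in> U \<inter> verts T. \<forall>v \<in> U \<inter> verts T. (u, v) \<in> (adj T \<inter> U \<times> U)\<^sup>*)"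

lemma connected_on_cong:
  assumes "U \<inter> verts T = U' \<inter> verts T"
  shows "connected_on T U \<longleftrightarrow> connected_on T U'"
proof -
  have "adj T \<inter> U \<times> U = adj T \<inter> U' \<times> U'" using assms unfolding adj_def by blast
  then show ?thesis by (simp add: connected_on_def assms)
qed

lemma connected_induced_iff:
  "connected_graph (induced T U) \<longleftrightarrow> verts T \<inter> U \<noteq> {} \<and> connected_on T U"
proof -
  have "adj (induced T U) = adj T \<inter> U \<times> U"
    by (auto simp: adj_def induced_def)
  then show ?thesis
    by (auto simp: connected_graph_iff connected_on_def induced_def)
qed

lemma connected_graph_iff_connected_on:
  "connected_graph T \<longleftrightarrow> verts T \<noteq> {} \<and> connected_on T UNIV"
  by (simp add: connected_graph_iff connected_on_def)

definition bridge_join :: "'a graph \<Rightarrow> 'a \<Rightarrow> 'a graph \<Rightarrow> 'a \<Rightarrow> 'a graph" where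
  "bridge_join S a T b =
     \<lparr>verts = verts S \<union> verts T, edges = insert {a, b} (edges S \<union> edges T)\<rparr>"

lemma connected_on_bridge_join:
  assumes S: "connected_on S U" and T: "connected_on T U"
    and ab: "a \<in> verts S" "b \<in> verts T"
    and meet: "U \<inter> verts S \<noteq> {} \<Longrightarrow> U \<inter> verts T \<noteq> {} \<Longrightarrow> a \<in> U \<and> b \<in> U"
  shows "connected_on (bridge_join S a T b) U"
proof -
  let ?R = "adj (bridge_join S a T b) \<inter> U \<times> U"
  have mS: "(adj S \<inter> U \<times> U)\<^sup>* \<subseteq> ?R\<^sup>*"
    by (rule rtrancl_mono) (auto simp: adj_def bridge_join_def)
  have mT: "(adj T \<inter> U \<times> U)\<^sup>* \<subseteq> ?R\<^sup>*"
    by (rule rtrancl_mono) (auto simp: adj_def bridge_join_def)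
  have inS: "(u, v) \<in> ?R\<^sup>*" if "u \<in> U" "v \<in> U" "u \<in> verts S" "v \<in> verts S" for u v
    using S that mS unfolding connected_on_def by blast
  have inT: "(u, v) \<in> ?R\<^sup>*" if "u \<in> U" "v \<in> U" "u \<in> verts T" "v \<in> verts T" for u v
    using T that mT unfolding connected_on_def by blast
  have cross: "(u, v) \<in> ?R\<^sup>*" "(v, u) \<in> ?R\<^sup>*"
    if "u \<in> U" "v \<in> U" "u \<in> verts S" "v \<in> verts T" for u v
  proof -
    have abU: "a \<in> U" "b \<in> U" using meet that by auto
    have "(a, b) \<in> ?R" "(b, a) \<in> ?R"
      using abU ab by (auto simp: adj_def bridge_join_def insert_commute)
    then show "(u, v) \<in> ?R\<^sup>*" "(v, u) \<in> ?R\<^sup>*"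
      using inS inT abU ab that by (meson rtrancl_trans r_into_rtrancl)+
  qed
  show ?thesis
    unfolding connected_on_def
    using inS inT cross by (auto simp: bridge_join_def)
qed

lemma tree_bridge_join:
  assumes S: "is_tree S" and T: "is_tree T" and dj: "verts S \<inter> verts T = {}"
    and ab: "a \<in> verts S" "b \<in> verts T"
  shows "is_tree (bridge_join S a T b)"
proof -
  let ?J = "bridge_join S a T b"
  have sS: "simple_graph S" and sT: "simple_graph T" using S T by (auto simp: is_tree_def)
  have simple: "simple_graph ?J"
    using sS sT ab dj unfolding simple_graph_def bridge_join_def by (auto simp: card_insert_if)
  have conn: "connected_graph ?J"
    using S T ab connected_on_bridge_join[of S UNIV T a b]
    by (auto simp: is_tree_def connected_graph_iff_connected_on bridge_join_def)
  have eS: "{x, y} \<in> edges S \<Longrightarrow> x \<in> verts S \<and> y \<in> verts S" for x y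
    using simple_graph_edge[OF sS] by blast
  have eT: "{x, y} \<in> edges T \<Longrightarrow> x \<in> verts T \<and> y \<in> verts T" for x y
    using simple_graph_edge[OF sT] by blast
  have sep: "v \<in> verts T \<Longrightarrow> v \<notin> verts S" for v using dj by blast
  have eJ: "{u, v} \<in> edges S \<or> {u, v} \<in> edges T \<or> (u = a \<and> v = b) \<or> (u = b \<and> v = a)"
    if "{u, v} \<in> edges ?J" for u v
    using that by (auto simp: bridge_join_def doubleton_eq_iff)
  \<comment> \<open>Collapsing the far side of the bridge maps walks of the join to walks of one tree.\<close>
  have project: "(p x, p y) \<in> (adj (remove_edge Q f))\<^sup>*"
    if r: "(x, y) \<in> (adj (remove_edge ?J f))\<^sup>*"
      and p: "\<And>u v. {u, v} \<in> edges ?J \<Longrightarrow> p u = p v \<or> p u = u \<and> p v = v \<and> {u, v} \<in> edges Q"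
      and "\<And>u v. {u, v} \<in> edges Q \<Longrightarrow> u \<in> verts Q \<and> v \<in> verts Q" for x y p f and Q :: "'a graph"
    using r
  proof (induction rule: rtrancl_induct)
    case (step u v)
    have uv: "{u, v} \<in> edges ?J" "{u, v} \<noteq> f"
      using step.hyps(2) by (auto simp: adj_def remove_edge_def)
    from p[OF uv(1)] show ?case
    proof
      assume "p u = p v"
      then show ?thesis using step.IH by simp
    next
      assume pq: "p u = u \<and> p v = v \<and> {u, v} \<in> edges Q"
      then have "u \<in> verts Q \<and> v \<in> verts Q" using that(3) by blast
      then have "(p u, p v) \<in> adj (remove_edge Q f)"
        using pq uv(2) by (simp add: adj_def remove_edge_def)
      then show ?thesis using step.IH by (rule rtrancl_into_rtrancl[rotated])
    qed
  qed simp
  have "(x, y) \<notin> (adj (remove_edge ?J {x, y}))\<^sup>*" if e: "{x, y} \<in> edges ?J" for x y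
  proof
    assume r: "(x, y) \<in> (adj (remove_edge ?J {x, y}))\<^sup>*"
    consider "{x, y} \<in> edges S" | "{x, y} \<in> edges T" | "{x, y} = {a, b}"
      using e by (auto simp: bridge_join_def)
    then show False
    proof cases
      case 1
      let ?p = "\<lambda>v. if v \<in> verts S then v else a"
      have "(?p x, ?p y) \<in> (adj (remove_edge S {x, y}))\<^sup>*"
      proof (rule project[OF r _ eS])
        fix u v assume "{u, v} \<in> edges ?J"
        from eJ[OF this] show "?p u = ?p v \<or> ?p u = u \<and> ?p v = v \<and> {u, v} \<in> edges S"
          using eS[of u v] eT[of u v] sep ab by auto
      qed
      then show False using 1 S eS[OF 1] by (auto simp: is_tree_iff)
    next
      case 2
      let ?p = "\<lambda>v. if v \<in> verts T then v else b"
      have "(?p x, ?p y) \<in> (adj (remove_edge T {x, y}))\<^sup>*"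
      proof (rule project[OF r _ eT])
        fix u v assume "{u, v} \<in> edges ?J"
        from eJ[OF this] show "?p u = ?p v \<or> ?p u = u \<and> ?p v = v \<and> {u, v} \<in> edges T"
          using eS[of u v] eT[of u v] sep ab by auto
      qed
      then show False using 2 T eT[OF 2] by (auto simp: is_tree_iff)
    next
      case 3
      have "v \<in> verts S \<longleftrightarrow> x \<in> verts S" if "(x, v) \<in> (adj (remove_edge ?J {x, y}))\<^sup>*" for v
        using that
      proof (induction rule: rtrancl_induct)
        case (step u v)
        then have "{u, v} \<in> edges S \<or> {u, v} \<in> edges T"
          using 3 by (auto simp: adj_def remove_edge_def bridge_join_def)
        then show ?case using step.IH eS[of u v] eT[of u v] dj by blast
      qed simp
      then show False using r 3 ab dj by (auto simp: doubleton_eq_iff)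
    qed
  qed
  then show ?thesis using simple conn by (simp add: is_tree_iff)
qed

definition point :: "'a \<Rightarrow> 'a graph" where
  "point v = \<lparr>verts = {v}, edges = {}\<rparr>"

lemma point_simps [simp]: "verts (point v) = {v}" "edges (point v) = {}"
  by (simp_all add: point_def)

lemma tree_point: "is_tree (point v)"
  by (simp add: is_tree_iff simple_graph_def connected_graph_iff point_def)

text \<open>Without this the minimum in the definition of rank-width would range over the empty set. Growing
two new leaves at an old leaf turns the latter into an inner node of degree 3 and raises the number
of leaves by one.\<close>

lemma ternary_tree_exists:
  assumes "n \<ge> 2"
  shows "\<exists>T :: nat graph. ternary_tree T \<and> card (leaves T) = n"
  using assms
proof (induction n rule: dec_induct)
  case base
  let ?T = "bridge_join (point (0::nat)) 0 (point 1) 1"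
  have T: "is_tree ?T" by (rule tree_bridge_join) (auto intro: tree_point)
  have e: "edges ?T = {{0, 1}}" and v: "verts ?T = {0, 1}"
    by (auto simp: bridge_join_def)
  have "degree ?T t = 1" if "t \<in> {0, 1}" for t
  proof -
    have "{e \<in> edges ?T. t \<in> e} = {{0, 1}}" using that e by auto
    then show ?thesis by (simp add: degree_def)
  qed
  then have "ternary_tree ?T" "leaves ?T = {0, 1}"
    using T v by (auto simp: ternary_tree_def leaves_def)
  then show ?case by (intro exI[of _ ?T]) (auto simp: card_insert_if)
next
  case (step n)
  then obtain T :: "nat graph" where T: "ternary_tree T" and n: "card (leaves T) = n" by blast
  have tree: "is_tree T" and sT: "simple_graph T"
    using T by (auto simp: ternary_tree_def is_tree_def)
  have fin: "finite (verts T)" and finE: "finite (edges T)"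
    using sT simple_graph_finite_edges by (auto simp: simple_graph_def)
  obtain t where t: "t \<in> verts T" "degree T t = 1"
  proof -
    have "leaves T \<noteq> {}" using n step.hyps by auto
    then show ?thesis using that by (auto simp: leaves_def)
  qed
  obtain a where a: "a \<notin> verts T" using fin ex_new_if_finite infinite_UNIV_nat by blast
  obtain b where b: "b \<notin> insert a (verts T)"
    using fin ex_new_if_finite infinite_UNIV_nat by (metis finite_insert)
  let ?J = "bridge_join T t (point a) a"
  let ?K = "bridge_join ?J t (point b) b"
  have "is_tree ?J" by (rule tree_bridge_join) (use tree t a tree_point in auto)
  then have K: "is_tree ?K"
    by (rule tree_bridge_join)
      (use t a b tree_point in \<open>auto simp: bridge_join_def\<close>)
  have vK: "verts ?K = verts T \<union> {a, b}" by (auto simp: bridge_join_def)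
  have eK: "edges ?K = edges T \<union> {{t, a}, {t, b}}" by (auto simp: bridge_join_def)
  have sub: "e \<subseteq> verts T" if "e \<in> edges T" for e using sT that by (auto simp: simple_graph_def)
  have dt: "degree ?K t = 3"
  proof -
    have "{e \<in> edges ?K. t \<in> e} = {e \<in> edges T. t \<in> e} \<union> {{t, a}, {t, b}}" using eK by auto
    moreover have "card \<dots> = card {e \<in> edges T. t \<in> e} + card {{t, a}, {t, b}}"
      by (rule card_Un_disjoint) (use finE sub a b in auto)
    moreover have "{t, a} \<noteq> {t, b}" using b by (auto simp: doubleton_eq_iff)
    ultimately show ?thesis using t by (simp add: degree_def)
  qed
  have da: "degree ?K a = 1"
  proof -
    have "{e \<in> edges ?K. a \<in> e} = {{t, a}}" using eK sub a b t by auto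
    then show ?thesis by (simp add: degree_def)
  qed
  have db: "degree ?K b = 1"
  proof -
    have "{e \<in> edges ?K. b \<in> e} = {{t, b}}" using eK sub a b t by auto
    then show ?thesis by (simp add: degree_def)
  qed
  have dv: "degree ?K v = degree T v" if "v \<in> verts T" "v \<noteq> t" for v
  proof -
    have "{e \<in> edges ?K. v \<in> e} = {e \<in> edges T. v \<in> e}" using eK that a b by auto
    then show ?thesis by (simp add: degree_def)
  qed
  have "ternary_tree ?K"
    unfolding ternary_tree_def using K T vK dt da db dv
    by (metis Un_iff insert_iff singletonD ternary_tree_def)
  moreover have "leaves ?K = (leaves T - {t}) \<union> {a, b}"
  proof (rule set_eqI)
    fix v show "v \<in> leaves ?K \<longleftrightarrow> v \<in> (leaves T - {t}) \<union> {a, b}"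
      by (cases "v = t"; cases "v = a"; cases "v = b"; cases "v \<in> verts T")
        (use t a b vK dt da db dv in \<open>auto simp: leaves_def\<close>)
  qed
  moreover have "card \<dots> = card (leaves T - {t}) + card {a, b}"
    by (rule card_Un_disjoint) (use fin a b in \<open>auto simp: leaves_def\<close>)
  moreover have "t \<in> leaves T" using t by (simp add: leaves_def)
  ultimately have "ternary_tree ?K \<and> card (leaves ?K) = Suc n"
    using n b step.hyps by (simp add: card_Diff_singleton)
  then show ?case by blast
qed

section \<open>Sparsity of rank-1 shallow minors\<close>

lemma finite_shallow_minor_ratios:
  assumes G: "finite (verts G)"
  shows "finite {real (card (edges H)) / real (card (verts H)) | H.
    shallow_minor d H G \<and> verts H \<noteq> {}}" (is "finite ?A")
proof -
  let ?V = "Pow (Pow (verts G))" and ?E = "Pow (Pow (Pow (verts G)))"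
  have "?A \<subseteq> (\<lambda>(V, E). real (card E) / real (card V)) ` (?V \<times> ?E)"
  proof
    fix q assume "q \<in> ?A"
    then obtain H :: "'a set graph" where q: "q = real (card (edges H)) / real (card (verts H))"
      and "shallow_minor d H G" by blast
    then obtain W S where W: "W \<subseteq> verts G" and S: "\<forall>B\<in>S. subgraph B (induced G W)"
      and v: "verts H = verts (contract (induced G W) S)"
      and e: "edges H \<subseteq> edges (contract (induced G W) S)"
      unfolding shallow_minor_def by metis
    have "verts (contract (induced G W) S) \<subseteq> Pow (verts G)"
      using W S by (fastforce simp: contract_def Let_def subgraph_def induced_def)
    moreover have "edges (contract (induced G W) S) \<subseteq> Pow (verts (contract (induced G W) S))"
      by (auto simp: contract_def Let_def)
    ultimately have "verts H \<in> ?V" "edges H \<in> ?E"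
      using v e by blast+
    then show "q \<in> (\<lambda>(V, E). real (card E) / real (card V)) ` (?V \<times> ?E)"
      using q by (auto intro!: image_eqI[of _ _ "(verts H, edges H)"])
  qed
  then show ?thesis using G by (meson finite_Pow_iff finite_SigmaI finite_imageI finite_subset)
qed

text \<open>The map \<open>p\<close> assigns each vertex of \<open>W\<close> to the centre of a star. Contracting all the stars gives a
minor on \<open>B\<close>, and \<open>E\<close> is a set of its edges. With \<open>p\<close> the identity this speaks about the subgraphs
of \<open>G\<close> itself.\<close>

lemma star_minor_edges_le:
  assumes G: "simple_graph G" and W: "W \<subseteq> verts G"
    and BW: "B \<subseteq> W" and Bne: "B \<noteq> {}"
    and p: "\<And>x. x \<in> W \<Longrightarrow> p x \<in> B" "\<And>b. b \<in> B \<Longrightarrow> p b = b"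
      "\<And>x. x \<in> W \<Longrightarrow> x \<noteq> p x \<Longrightarrow> {p x, x} \<in> edges G"
    and E: "\<And>e. e \<in> E \<Longrightarrow> \<exists>x\<in>W. \<exists>y\<in>W. p x \<noteq> p y \<and> e = {p x, p y} \<and> {x, y} \<in> edges G"
  shows "real (card E) \<le> nabla 1 G * real (card B)"
proof -
  define fiber where "fiber b = {x \<in> W. p x = b}" for b
  define star where "star b = \<lparr>verts = fiber b, edges = {{b, x} | x. x \<in> fiber b \<and> x \<noteq> b}\<rparr>" for b
  define H where "H = \<lparr>verts = fiber ` B, edges = (`) fiber ` E\<rparr>"
  have finV: "finite (verts G)" using G by (simp add: simple_graph_def)
  have finB: "finite B" using finV W BW by (meson finite_subset)
  have mem: "b \<in> fiber b" if "b \<in> B" for b using that BW p by (auto simp: fiber_def)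
  have inj: "inj_on fiber B"
  proof (rule inj_onI)
    fix b c assume "b \<in> B" "c \<in> B" "fiber b = fiber c"
    then have "b \<in> fiber c" "p b = b" using mem p(2) by auto
    then show "b = c" by (simp add: fiber_def)
  qed
  have EB: "E \<subseteq> Pow B" using E p by fastforce
  have sub: "subgraph (star b) (induced G W)" if "b \<in> B" for b
    using that W BW p finV mem[OF that] unfolding subgraph_def simple_graph_def star_def induced_def
    by (auto simp: fiber_def card_insert_if intro: finite_subset)
  have rad: "radius_at_most 1 (star b)" if "b \<in> B" for b
    unfolding radius_at_most_def
  proof (intro bexI ballI)
    fix v assume v: "v \<in> verts (star b)"
    show "\<exists>xs. walk (star b) b xs v \<and> length xs - 1 \<le> 1"
    proof (cases "v = b")
      case True
      then show ?thesis using v by (intro exI[of _ "[b]"]) (auto simp: walk_def)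
    next
      case False
      then show ?thesis using v mem[OF that]
        by (intro exI[of _ "[b, v]"]) (auto simp: walk_def star_def)
    qed
  qed (use mem[OF that] in \<open>simp add: star_def\<close>)
  have vs: "verts (star b) = fiber b" for b by (simp add: star_def)
  have verts_contract: "verts (contract (induced G W) (star ` B)) = fiber ` B"
  proof -
    have "\<exists>b\<in>B. v \<in> fiber b" if "v \<in> W" for v using that p by (auto simp: fiber_def)
    then show ?thesis by (auto simp: contract_def Let_def image_image vs induced_def)
  qed
  have edges_contract: "edges H \<subseteq> edges (contract (induced G W) (star ` B))"
  proof
    fix f assume "f \<in> edges H"
    then obtain e where "e \<in> E" "f = fiber ` e" by (auto simp: H_def)
    then obtain x y where xy: "x \<in> W" "y \<in> W" "p x \<noteq> p y" "{x, y} \<in> edges G"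
      and f: "f = {fiber (p x), fiber (p y)}" using E[of e] by auto
    have "fiber (p x) \<noteq> fiber (p y)" using inj xy p by (auto simp: inj_on_def)
    moreover have "\<exists>a\<in>fiber (p x). \<exists>c\<in>fiber (p y). {a, c} \<in> edges (induced G W)"
      using xy by (intro bexI[of _ x] bexI[of _ y]) (auto simp: induced_def fiber_def)
    moreover have "fiber (p x) \<in> fiber ` B" "fiber (p y) \<in> fiber ` B" using xy p by auto
    ultimately have "f \<in> {{A, C} | A C. A \<in> fiber ` B \<and> C \<in> fiber ` B \<and> A \<noteq> C \<and>
        (\<exists>a\<in>A. \<exists>c\<in>C. {a, c} \<in> edges (induced G W))}"
      using f by blast
    then show "f \<in> edges (contract (induced G W) (star ` B))"
      using verts_contract by (simp add: contract_def Let_def)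
  qed
  have "shallow_minor 1 H G"
    unfolding shallow_minor_def
  proof (intro exI conjI)
    show "\<forall>C\<in>star ` B. subgraph C (induced G W) \<and> radius_at_most 1 C" using sub rad by blast
    show "pairwise (\<lambda>B C. verts B \<inter> verts C = {}) (star ` B)"
      by (auto simp: pairwise_def vs fiber_def)
  qed (use W edges_contract verts_contract in \<open>auto simp: H_def\<close>)
  moreover have "verts H \<noteq> {}" using Bne by (simp add: H_def)
  ultimately have "real (card (edges H)) / real (card (verts H)) \<in>
      {real (card (edges H)) / real (card (verts H)) | H. shallow_minor 1 H G \<and> verts H \<noteq> {}}"
    by blast
  then have "real (card (edges H)) / real (card (verts H)) \<le> nabla 1 G"
    unfolding nabla_def by (rule Max_ge[OF finite_shallow_minor_ratios[OF finV]])
  moreover have "card (edges H) = card E"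
  proof -
    have "inj_on ((`) fiber) E"
      using inj_on_image_Pow[OF inj] EB by (meson inj_on_subset)
    then show ?thesis by (simp add: H_def card_image)
  qed
  moreover have "card (verts H) = card B" by (simp add: H_def card_image inj)
  moreover have "card B > 0" using finB Bne by (simp add: card_gt_0_iff)
  ultimately show ?thesis by (simp add: divide_simps)
qed

text \<open>A complete bipartite subgraph with both sides of size \<open>d + 1\<close> has \<open>(d + 1)\<^sup>2\<close> edges on
\<open>2 * (d + 1)\<close> vertices, and \<open>(d + 1) / 2\<close> exceeds \<open>r\<close>.\<close>

lemma no_large_biclique:
  assumes G: "simple_graph G" and r: "nabla 1 G \<le> r"
    and AC: "A \<subseteq> verts G" "C \<subseteq> verts G"
    and adj: "\<And>a c. a \<in> A \<Longrightarrow> c \<in> C \<Longrightarrow> {a, c} \<in> edges G"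
    and d: "d = nat \<lfloor>2 * r\<rfloor>"
  shows "card A \<le> d \<or> card C \<le> d"
proof (rule ccontr)
  assume "\<not> ?thesis"
  then have "Suc d \<le> card A" "Suc d \<le> card C" by auto
  then obtain A' C' where A': "A' \<subseteq> A" "card A' = Suc d" "finite A'"
    and C': "C' \<subseteq> C" "card C' = Suc d" "finite C'" by (meson obtain_subset_with_card_n)
  have ne: "a \<noteq> c" if "a \<in> A" "c \<in> C" for a c
    using adj[OF that] G by (auto simp: simple_graph_def)
  then have dj: "A' \<inter> C' = {}" using A' C' by blast
  let ?E = "(\<lambda>(a, c). {a, c}) ` (A' \<times> C')"
  have "real (card ?E) \<le> nabla 1 G * real (card (A' \<union> C'))"
  proof (rule star_minor_edges_le[where W = "A' \<union> C'" and p = "\<lambda>x. x"])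
    show "A' \<union> C' \<noteq> {}" using A' by auto
    fix e assume "e \<in> ?E"
    then obtain a c where "a \<in> A'" "c \<in> C'" "e = {a, c}" by auto
    then show "\<exists>x\<in>A' \<union> C'. \<exists>y\<in>A' \<union> C'. x \<noteq> y \<and> e = {x, y} \<and> {x, y} \<in> edges G"
      using A' C' adj ne by blast
  qed (use G AC A' C' in auto)
  moreover have "inj_on (\<lambda>(a, c). {a, c}) (A' \<times> C')"
    using dj by (auto simp: inj_on_def doubleton_eq_iff)
  then have "card ?E = Suc d * Suc d"
    using A' C' by (simp add: card_image card_cartesian_product)
  moreover have "card (A' \<union> C') = 2 * Suc d" using A' C' dj by (simp add: card_Un_disjoint)
  ultimately have "real (Suc d) * real (Suc d) \<le> (nabla 1 G * 2) * real (Suc d)"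
    by (simp only: of_nat_mult of_nat_numeral mult.assoc)
  then have "real (Suc d) \<le> nabla 1 G * 2" by (rule mult_right_le_imp_le) simp
  then have "real (Suc d) \<le> 2 * r" using r by linarith
  then show False using d by linarith
qed

section \<open>Counting neighbourhoods across a cut\<close>

lemma bit_eq_0_or_1: "(c::bit) = 0 \<or> c = 1" by (cases c) auto

lemma gf2_scale_simps [simp]: "gf2_scale 0 f = 0" "gf2_scale 1 f = f"
  by (auto simp: gf2_scale_def fun_eq_iff)

text \<open>The row rank bounds the number of columns that are needed to tell vectors of a span apart. When a
vector \<open>s\<close> is added to \<open>S\<close>, at most one nonzero vector of the new span can vanish on \<open>B\<close>: over
GF(2) two of them would differ by an element of the old span that vanishes on \<open>B\<close>. One more
coordinate detects it.\<close>

lemma separating_coordinates_span: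
  assumes "finite S"
  shows "\<exists>B. finite B \<and> card B \<le> card S \<and> (\<forall>f \<in> gf2.span S. (\<forall>b\<in>B. f b = 0) \<longrightarrow> f = 0)"
  using assms
proof (induction S)
  case empty
  then show ?case by (intro exI[of _ "{}"]) simp
next
  case (insert s S)
  then obtain B where B: "finite B" "card B \<le> card S"
    and sep: "\<And>f. f \<in> gf2.span S \<Longrightarrow> \<forall>b\<in>B. f b = 0 \<Longrightarrow> f = 0" by blast
  show ?case
  proof (cases "\<exists>f \<in> gf2.span (insert s S). (\<forall>b\<in>B. f b = 0) \<and> f \<noteq> 0")
    case False
    then have "\<forall>f \<in> gf2.span (insert s S). (\<forall>b\<in>B. f b = 0) \<longrightarrow> f = 0" by blast
    moreover have "card B \<le> card (insert s S)" using B insert.hyps by simp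
    ultimately show ?thesis using B(1) by blast
  next
    case True
    then obtain f x where f: "f \<in> gf2.span (insert s S)" "\<forall>b\<in>B. f b = 0" "f x \<noteq> 0"
      by (auto simp: fun_eq_iff)
    have shift: "h - s \<in> gf2.span S"
      if h: "h \<in> gf2.span (insert s S)" "\<forall>b\<in>B. h b = 0" "h \<noteq> 0" for h
    proof -
      obtain c where c: "h - gf2_scale c s \<in> gf2.span S"
        using h(1) gf2.span_breakdown_eq by blast
      moreover have "c \<noteq> 0" using c sep[of h] h by auto
      ultimately show ?thesis using bit_eq_0_or_1[of c] by auto
    qed
    have "h = 0" if h: "h \<in> gf2.span (insert s S)" "\<forall>b \<in> insert x B. h b = 0" for h
    proof (rule ccontr)
      assume "h \<noteq> 0"
      then have "h - s \<in> gf2.span S" using shift h by auto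
      moreover have "f - s \<in> gf2.span S" using shift f by (auto simp: fun_eq_iff)
      ultimately have "(h - s) - (f - s) \<in> gf2.span S" by (rule gf2.span_diff)
      then have "h - f \<in> gf2.span S" by simp
      then have "h - f = 0" using f(2) h(2) by (intro sep) auto
      then show False using f(3) h(2) by auto
    qed
    moreover have "card (insert x B) \<le> card (insert s S)"
      using B insert.hyps by (simp add: card_insert_if)
    moreover have "finite (insert x B)" using B by simp
    ultimately show ?thesis by blast
  qed
qed

definition nbs :: "'a graph \<Rightarrow> 'a set \<Rightarrow> 'a \<Rightarrow> 'a set" where
  "nbs G X v = {w \<in> verts G - X. {v, w} \<in> edges G}"

lemma nbs_subset_eq: "X \<subseteq> Z \<Longrightarrow> nbs G Z v = nbs G X v - Z"
  by (auto simp: nbs_def)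

text \<open>The empty set is included so that no nonempty neighbourhood has an empty trace on \<open>B\<close>.\<close>

lemma separating_columns:
  assumes X: "finite X"
  obtains B where "B \<subseteq> verts G - X" "finite B" "card B \<le> cut_rank G X"
    "inj_on (\<lambda>N. N \<inter> B) (insert {} (nbs G X ` X))"
proof -
  let ?R = "cut_row G X ` X"
  obtain S where S: "S \<subseteq> ?R" "?R \<subseteq> gf2.span S" "card S = gf2.dim ?R"
    using gf2.basis_exists by metis
  have "finite S" using S X finite_subset by blast
  from separating_coordinates_span[OF this]
  obtain B0 where B0: "finite B0" "card B0 \<le> card S"
    and sep: "\<And>f. f \<in> gf2.span S \<Longrightarrow> \<forall>b\<in>B0. f b = 0 \<Longrightarrow> f = 0" by blast
  let ?B = "B0 \<inter> (verts G - X)"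
  define ind :: "'a set \<Rightarrow> 'a \<Rightarrow> bit" where "ind N = (\<lambda>w. if w \<in> N then 1 else 0)" for N
  have row: "cut_row G X v = ind (nbs G X v)" for v
    by (auto simp: cut_row_def nbs_def ind_def fun_eq_iff)
  have inV: "ind N \<in> gf2.span S" "N \<subseteq> verts G - X" if N: "N \<in> insert {} (nbs G X ` X)" for N
  proof -
    have "ind {} = 0" by (simp add: ind_def fun_eq_iff)
    then show "ind N \<in> gf2.span S" using N S(2) gf2.span_zero[of S] by (auto simp flip: row)
    show "N \<subseteq> verts G - X" using N by (auto simp: nbs_def)
  qed
  have "inj_on (\<lambda>N. N \<inter> ?B) (insert {} (nbs G X ` X))"
  proof (rule inj_onI)
    fix M N assume M: "M \<in> insert {} (nbs G X ` X)" and N: "N \<in> insert {} (nbs G X ` X)"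
      and eq: "M \<inter> ?B = N \<inter> ?B"
    have "ind M - ind N = 0"
    proof (rule sep)
      show "ind M - ind N \<in> gf2.span S" by (intro gf2.span_diff inV M N)
      show "\<forall>b\<in>B0. (ind M - ind N) b = 0"
        using eq inV(2)[OF M] inV(2)[OF N] by (auto simp: ind_def)
    qed
    then have "ind M = ind N" by (rule iffD1[OF right_minus_eq])
    moreover have "w \<in> N \<longleftrightarrow> ind N w = 1" for w N by (simp add: ind_def)
    ultimately show "M = N" by auto
  qed
  moreover have "card ?B \<le> cut_rank G X"
    using B0 S by (metis card_mono cut_rank_def inf_le1 le_trans)
  ultimately show ?thesis using that[of ?B] B0(1) by auto
qed

definition cliques :: "'a set set \<Rightarrow> 'a set \<Rightarrow> 'a set set" where
  "cliques E B = {K. K \<subseteq> B \<and> K \<noteq> {} \<and> (\<forall>x\<in>K. \<forall>y\<in>K. x \<noteq> y \<longrightarrow> {x, y} \<in> E)}"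

lemma finite_cliques: "finite B \<Longrightarrow> finite (cliques E B)"
  by (rule finite_subset[of _ "Pow B"]) (auto simp: cliques_def)

text \<open>The sets of \<open>F\<close> are taken by increasing size. A set that is not yet a clique is spent on a new
edge between two of its elements; \<open>g\<close> records which set pays for which edge. A pair cannot be
left over: were it already an edge, the set that paid for this edge would contain the pair without
being larger, so it would be the same set.\<close>

lemma sets_injected_to_cliques:
  assumes "finite F" "\<And>S. S \<in> F \<Longrightarrow> S \<subseteq> B \<and> S \<noteq> {}" and B: "finite B"
  shows "\<exists>E g. E \<subseteq> {e. e \<subseteq> B \<and> card e = 2} \<and> inj_on g E \<and> (\<forall>e\<in>E. g e \<in> F \<and> e \<subseteq> g e) \<and>
    F - g ` E \<subseteq> cliques E B \<inter> {K. card K \<noteq> 2}"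
  using assms(1,2)
proof (induction F rule: finite_ranking_induct[where f = card])
  case empty
  then show ?case by (intro exI[of _ "{}"]) auto
next
  case (insert S F)
  then obtain E g where E: "E \<subseteq> {e. e \<subseteq> B \<and> card e = 2}" and inj: "inj_on g E"
    and g: "\<And>e. e \<in> E \<Longrightarrow> g e \<in> F \<and> e \<subseteq> g e"
    and rest: "F - g ` E \<subseteq> cliques E B \<inter> {K. card K \<noteq> 2}" by (metis (no_types, lifting) insert_iff)
  have S: "S \<subseteq> B" "S \<noteq> {}" "finite S" using insert.prems B by (auto intro: finite_subset)
  consider "S \<in> F" | "S \<notin> F" "S \<in> cliques E B" | "S \<notin> F" "S \<notin> cliques E B" by blast
  then show ?case
  proof cases
    case 1
    then have "insert S F = F" by blast
    then show ?thesis using E inj g rest by (intro exI[of _ E] exI[of _ g]) auto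
  next
    case 2
    have "card S \<noteq> 2"
    proof
      assume "card S = 2"
      then have "S \<in> E" using 2(2) by (auto simp: cliques_def card_2_iff)
      then have gS: "g S \<in> F" "S \<subseteq> g S" using g by auto
      then have "card (g S) \<le> card S" using insert.hyps by auto
      moreover have "finite (g S)" using gS insert.prems B by (meson finite_subset insertI2)
      ultimately have "g S = S" using gS(2) card_seteq by metis
      then show False using gS 2(1) by simp
    qed
    then show ?thesis using E inj g rest 2 by (intro exI[of _ E] exI[of _ g]) auto
  next
    case 3
    then obtain x y where xy: "x \<in> S" "y \<in> S" "x \<noteq> y" "{x, y} \<notin> E"
      using S by (auto simp: cliques_def)
    let ?E = "insert {x, y} E" and ?g = "g({x, y} := S)"
    have g': "?g e = g e" if "e \<in> E" for e using that xy by auto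
    have im: "?g ` E = g ` E" using g' by (intro image_cong) auto
    have "?E \<subseteq> {e. e \<subseteq> B \<and> card e = 2}" using E xy S by auto
    moreover have "inj_on ?g ?E"
    proof -
      have "inj_on ?g E" using inj g' by (simp cong: inj_on_cong)
      moreover have "S \<notin> ?g ` E" using im g 3(1) by auto
      ultimately show ?thesis using xy by auto
    qed
    moreover have "\<forall>e\<in>?E. ?g e \<in> insert S F \<and> e \<subseteq> ?g e" using g xy by auto
    moreover have "insert S F - ?g ` ?E \<subseteq> cliques ?E B \<inter> {K. card K \<noteq> 2}"
    proof -
      have "insert S F - ?g ` ?E \<subseteq> F - g ` E" using im by auto
      also note rest
      also have "cliques E B \<inter> {K. card K \<noteq> 2} \<subseteq> cliques ?E B \<inter> {K. card K \<noteq> 2}"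
        by (auto simp: cliques_def)
      finally show ?thesis .
    qed
    ultimately show ?thesis by (intro exI[of _ ?E] exI[of _ ?g] conjI)
  qed
qed

text \<open>The edges of \<open>E\<close>, which number as many as the sets that paid for them, are exactly the cliques of
size 2, and the sets left over are cliques of other sizes.\<close>

lemma card_injected_le_cliques:
  assumes F: "finite F" and B: "finite B"
    and E: "E \<subseteq> {e. e \<subseteq> B \<and> card e = 2}"
    and g: "inj_on g E" "\<forall>e\<in>E. g e \<in> F"
    and rest: "F - g ` E \<subseteq> cliques E B \<inter> {K. card K \<noteq> 2}"
  shows "card F \<le> card (cliques E B)"
proof -
  have finE: "finite E" by (rule finite_subset[of _ "Pow B"]) (use E B in auto)
  have sub: "E \<subseteq> cliques E B"
    using E by (fastforce simp: cliques_def card_2_iff insert_commute)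
  have "card F = card (g ` E) + card (F - g ` E)"
  proof -
    have "F = g ` E \<union> (F - g ` E)" using g by auto
    moreover have "card (g ` E \<union> (F - g ` E)) = card (g ` E) + card (F - g ` E)"
      by (rule card_Un_disjoint) (use finE F in auto)
    ultimately show ?thesis by simp
  qed
  also have "card (g ` E) = card E" using g by (simp add: card_image)
  also have "card E + card (F - g ` E) = card (E \<union> (F - g ` E))"
    by (rule card_Un_disjoint[symmetric]) (use finE F E rest in auto)
  also have "\<dots> \<le> card (cliques E B)"
    by (rule card_mono) (use finite_cliques[OF B] sub rest in auto)
  finally show ?thesis .
qed

text \<open>A vertex of minimum degree has at most \<open>2 * r\<close> neighbours, hence lies in at most
\<open>2 powr (2 * r) = 4 powr r\<close> cliques; the rest follows by induction after its removal. The last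
vertex contributes a single clique, which accounts for the summand 1.\<close>

lemma card_cliques_le:
  fixes r :: real
  assumes "finite B" "B \<noteq> {}" and E: "E \<subseteq> {e. card e = 2}"
    and sparse: "\<And>W. W \<subseteq> B \<Longrightarrow> W \<noteq> {} \<Longrightarrow> real (card {e \<in> E. e \<subseteq> W}) \<le> r * real (card W)"
  shows "real (card (cliques E B)) \<le> 4 powr r * (real (card B) - 1) + 1"
  using assms(1,2) sparse
proof (induction "card B" arbitrary: B rule: less_induct)
  case less
  note fin = less.prems(1)
  show ?case
  proof (cases "card B = 1")
    case True
    then obtain b where "B = {b}" by (auto simp: card_1_singleton_iff)
    then have "cliques E B \<subseteq> {{b}}" by (auto simp: cliques_def)
    then have "card (cliques E B) \<le> card {{b}}" by (rule card_mono[rotated]) simp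
    then show ?thesis using True by simp
  next
    case False
    let ?N = "\<lambda>v. {w \<in> B. {v, w} \<in> E}"
    let ?EB = "{e \<in> E. e \<subseteq> B}"
    have finEB: "finite ?EB" using fin by (auto intro: finite_subset[of _ "Pow B"])
    \<comment> \<open>Double counting of incidences gives a vertex of degree at most \<open>2 * r\<close>.\<close>
    have "(\<Sum>v\<in>B. card (?N v)) = (\<Sum>v\<in>B. card {e \<in> ?EB. v \<in> e})"
    proof (rule sum.cong[OF refl])
      fix v assume v: "v \<in> B"
      have "bij_betw (\<lambda>w. {v, w}) (?N v) {e \<in> ?EB. v \<in> e}"
        unfolding bij_betw_def
      proof
        show "inj_on (\<lambda>w. {v, w}) (?N v)" by (auto simp: inj_on_def doubleton_eq_iff)
        show "(\<lambda>w. {v, w}) ` ?N v = {e \<in> ?EB. v \<in> e}"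
        proof
          show "{e \<in> ?EB. v \<in> e} \<subseteq> (\<lambda>w. {v, w}) ` ?N v"
          proof
            fix e assume e: "e \<in> {e \<in> ?EB. v \<in> e}"
            then obtain w where "e = {v, w}" using E by (auto simp: card_2_iff)
            then show "e \<in> (\<lambda>w. {v, w}) ` ?N v" using e by auto
          qed
        qed (use v in auto)
      qed
      then show "card (?N v) = card {e \<in> ?EB. v \<in> e}" by (rule bij_betw_same_card)
    qed
    also have "\<dots> = (\<Sum>e\<in>?EB. card {v \<in> B. v \<in> e})"
      by (rule sum_multicount_gen) (use fin finEB in auto)
    also have "\<dots> = (\<Sum>e\<in>?EB. 2)"
    proof (rule sum.cong[OF refl])
      fix e assume "e \<in> ?EB"
      moreover from this have "{v \<in> B. v \<in> e} = e" by auto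
      ultimately show "card {v \<in> B. v \<in> e} = 2" using E by auto
    qed
    finally have "(\<Sum>v\<in>B. card (?N v)) = 2 * card ?EB" by simp
    then have "real (\<Sum>v\<in>B. card (?N v)) = real (2 * card ?EB)" by (rule arg_cong)
    then have "(\<Sum>v\<in>B. real (card (?N v))) = 2 * real (card ?EB)"
      by (simp only: of_nat_sum of_nat_mult of_nat_numeral)
    moreover have "real (card ?EB) \<le> r * real (card B)" using less.prems by blast
    ultimately have le: "(\<Sum>v\<in>B. real (card (?N v))) \<le> 2 * r * real (card B)" by linarith
    then have "\<exists>v\<in>B. real (card (?N v)) \<le> 2 * r"
    proof -
      have False if "\<And>v. v \<in> B \<Longrightarrow> real (card (?N v)) > 2 * r"
      proof -
        have "(\<Sum>v\<in>B. 2 * r) < (\<Sum>v\<in>B. real (card (?N v)))"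
          by (rule sum_strict_mono) (use less.prems that in auto)
        then show False using le by (simp add: mult.commute)
      qed
      then show ?thesis by (meson linorder_not_le)
    qed
    then obtain v where v: "v \<in> B" and deg: "real (card (?N v)) \<le> 2 * r" by blast
    let ?B = "B - {v}"
    have "cliques E B \<subseteq> cliques E ?B \<union> insert v ` Pow (?N v)"
    proof
      fix K assume K: "K \<in> cliques E B"
      show "K \<in> cliques E ?B \<union> insert v ` Pow (?N v)"
      proof (cases "v \<in> K")
        case True
        then have "K = insert v (K - {v})" "K - {v} \<in> Pow (?N v)"
          using K by (auto simp: cliques_def)
        then show ?thesis by blast
      qed (use K in \<open>auto simp: cliques_def\<close>)
    qed
    then have "card (cliques E B) \<le> card (cliques E ?B \<union> insert v ` Pow (?N v))"
      by (rule card_mono[rotated]) (use fin finite_cliques in auto)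
    also have "\<dots> \<le> card (cliques E ?B) + card (insert v ` Pow (?N v))" by (rule card_Un_le)
    finally have "card (cliques E B) \<le> card (cliques E ?B) + card (insert v ` Pow (?N v))" .
    moreover have "card (insert v ` Pow (?N v)) \<le> 2 ^ card (?N v)"
      using card_image_le[of "Pow (?N v)" "insert v"] fin by (simp add: card_Pow)
    ultimately have "card (cliques E B) \<le> card (cliques E ?B) + 2 ^ card (?N v)" by linarith
    then have "real (card (cliques E B)) \<le> real (card (cliques E ?B) + 2 ^ card (?N v))"
      by (simp only: of_nat_le_iff)
    then have "real (card (cliques E B)) \<le> real (card (cliques E ?B)) + 2 ^ card (?N v)" by simp
    moreover have "(2::real) ^ card (?N v) \<le> 4 powr r"
    proof -
      have "(2::real) ^ card (?N v) = 2 powr real (card (?N v))" by (simp add: powr_realpow)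
      also have "\<dots> \<le> 2 powr (2 * r)" using deg by simp
      also have "\<dots> = 4 powr r" by (simp flip: powr_powr)
      finally show ?thesis .
    qed
    moreover have "real (card (cliques E ?B)) \<le> 4 powr r * (real (card ?B) - 1) + 1"
    proof (rule less.hyps)
      have "card B > 0" using v fin by (auto simp: card_gt_0_iff)
      then have c: "card ?B > 0" "card ?B < card B" using v fin False by auto
      show "card ?B < card B" by fact
      show "?B \<noteq> {}" using c by (metis card.empty less_irrefl)
    qed (use less.prems in auto)
    moreover have "real (card ?B) = real (card B) - 1"
      using card.remove[OF fin v] by simp
    ultimately show ?thesis by (simp add: algebra_simps)
  qed
qed

text \<open>Here \<open>rep\<close> chooses a vertex of \<open>X\<close> for each trace on \<open>B\<close>. The graph \<open>E\<close> on \<open>B\<close> is sparse on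
every \<open>W \<subseteq> B\<close>: contracting the vertices chosen for the edges inside \<open>W\<close> into one end of their edge
realises these edges in a minor on \<open>W\<close>.\<close>

lemma card_nbs_le:
  assumes G: "simple_graph G" and r: "nabla 1 G \<le> r"
    and X: "X \<subseteq> verts G" and k: "cut_rank G X \<le> k" "1 \<le> k"
  shows "real (card (nbs G X ` X - {{}})) \<le> 4 powr r * (real k - 1) + 1"
proof -
  have finX: "finite X" using X G by (meson finite_subset simple_graph_def)
  obtain B where B: "B \<subseteq> verts G - X" "finite B" "card B \<le> cut_rank G X"
    and inj: "inj_on (\<lambda>N. N \<inter> B) (insert {} (nbs G X ` X))"
    using separating_columns[OF finX] .
  define F where "F = (\<lambda>N. N \<inter> B) ` (nbs G X ` X - {{}})"
  have "inj_on (\<lambda>N. N \<inter> B) (nbs G X ` X - {{}})" using inj by (rule inj_on_subset) auto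
  then have cardF: "card F = card (nbs G X ` X - {{}})" by (simp add: F_def card_image)
  have finF: "finite F" using finX by (simp add: F_def)
  have F: "S \<subseteq> B \<and> S \<noteq> {}" if S: "S \<in> F" for S
  proof -
    obtain x where x: "x \<in> X" "nbs G X x \<noteq> {}" "S = nbs G X x \<inter> B" using S by (auto simp: F_def)
    then have "nbs G X x \<inter> B \<noteq> {} \<inter> B" using inj_onD[OF inj, of "nbs G X x" "{}"] by auto
    then show ?thesis using x by auto
  qed
  have "\<forall>S\<in>F. \<exists>x\<in>X. S = nbs G X x \<inter> B" by (auto simp: F_def)
  then obtain rep where rep: "\<And>S. S \<in> F \<Longrightarrow> rep S \<in> X \<and> S = nbs G X (rep S) \<inter> B" by metis
  have nonneg: "0 \<le> 4 powr r * (real k - 1)" using k by simp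
  show ?thesis
  proof (cases "B = {}")
    case True
    then have "F = {}" using F by auto
    then have "card (nbs G X ` X - {{}}) = 0" using cardF by simp
    then show ?thesis using nonneg by simp
  next
    case False
    have "\<exists>E g. E \<subseteq> {e. e \<subseteq> B \<and> card e = 2} \<and> inj_on g E \<and> (\<forall>e\<in>E. g e \<in> F \<and> e \<subseteq> g e) \<and>
        F - g ` E \<subseteq> cliques E B \<inter> {K. card K \<noteq> 2}"
      using F by (intro sets_injected_to_cliques finF B(2))
    then obtain E g where E: "E \<subseteq> {e. e \<subseteq> B \<and> card e = 2}" and g: "inj_on g E"
      "\<forall>e\<in>E. g e \<in> F \<and> e \<subseteq> g e"
      and rest: "F - g ` E \<subseteq> cliques E B \<inter> {K. card K \<noteq> 2}"
      by (elim exE conjE)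
    have sparse: "real (card {e \<in> E. e \<subseteq> W}) \<le> r * real (card W)"
      if W: "W \<subseteq> B" "W \<noteq> {}" for W
    proof -
      let ?EW = "{e \<in> E. e \<subseteq> W}"
      let ?x = "\<lambda>e. rep (g e)"
      define q where "q e = (SOME b. b \<in> e)" for e :: "'a set"
      have q: "q e \<in> e" if "e \<in> ?EW" for e
      proof -
        have "e \<noteq> {}" using that E by auto
        then show ?thesis by (simp add: q_def some_in_eq)
      qed
      define p where "p x = (if x \<in> W then x else q (inv_into ?EW ?x x))" for x
      have xX: "?x e \<in> X" if "e \<in> ?EW" for e using rep g that by blast
      have xW: "?x e \<notin> W" if "e \<in> ?EW" for e using xX[OF that] B(1) W by blast
      have nb: "{?x e, b} \<in> edges G" if "e \<in> ?EW" "b \<in> e" for e b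
      proof -
        have "b \<in> nbs G X (?x e)" using rep[of "g e"] g(2) that by blast
        then show ?thesis by (simp add: nbs_def)
      qed
      have injx: "inj_on ?x ?EW"
      proof (rule inj_onI)
        fix e f assume ef: "e \<in> ?EW" "f \<in> ?EW" "?x e = ?x f"
        then have "g e = g f" using rep[of "g e"] rep[of "g f"] g(2) by auto
        then show "e = f" using g(1) ef by (auto dest: inj_onD)
      qed
      have px: "p (?x e) = q e" if "e \<in> ?EW" for e
        using xW[OF that] inv_into_f_f[OF injx that] by (simp add: p_def)
      have "real (card ?EW) \<le> nabla 1 G * real (card W)"
      proof (rule star_minor_edges_le[OF G, where W = "W \<union> ?x ` ?EW" and p = p])
        show "W \<union> ?x ` ?EW \<subseteq> verts G" using W B(1) xX X by blast
        show "p x \<in> W" if x: "x \<in> W \<union> ?x ` ?EW" for x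
        proof (cases "x \<in> W")
          case False
          then obtain e where "e \<in> ?EW" "x = ?x e" using x by blast
          then show ?thesis using px[of e] q[of e] by auto
        qed (simp add: p_def)
        show "{p x, x} \<in> edges G" if x: "x \<in> W \<union> ?x ` ?EW" "x \<noteq> p x" for x
        proof -
          have "x \<notin> W" using x by (auto simp: p_def)
          then obtain e where e: "e \<in> ?EW" "x = ?x e" using x by blast
          then have "{x, p x} \<in> edges G" using px[of e] q[of e] nb[of e "q e"] by simp
          then show ?thesis by (simp add: insert_commute)
        qed
        show "\<exists>x\<in>W \<union> ?x ` ?EW. \<exists>y\<in>W \<union> ?x ` ?EW. p x \<noteq> p y \<and> e = {p x, p y} \<and> {x, y} \<in> edges G"
          if e: "e \<in> ?EW" for e
        proof -
          have "card e = 2" using e E by auto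
          then obtain a b where ab: "e = {a, b}" "a \<noteq> b" by (auto simp: card_2_iff)
          have "q e = a \<or> q e = b" using q[OF e] ab(1) by blast
          then obtain v where v: "e = {q e, v}" "q e \<noteq> v" using ab by (metis insert_commute)
          then have vW: "v \<in> W" using e by blast
          have "p v = v" using vW by (simp add: p_def)
          moreover have "{?x e, v} \<in> edges G" by (rule nb[OF e]) (use v in blast)
          moreover have "?x e \<in> W \<union> ?x ` ?EW" "v \<in> W \<union> ?x ` ?EW" using e vW by blast+
          ultimately show ?thesis using px[OF e] v
            by (intro bexI[of _ "?x e"] bexI[of _ v] conjI) simp_all
        qed
      qed (use W in \<open>auto simp: p_def\<close>)
      also have "\<dots> \<le> r * real (card W)" using r by (rule mult_right_mono) simp
      finally show ?thesis .
    qed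
    have "real (card F) \<le> real (card (cliques E B))"
      using card_injected_le_cliques[OF finF B(2) E g(1) _ rest] g(2) by simp
    also have "\<dots> \<le> 4 powr r * (real (card B) - 1) + 1"
      by (rule card_cliques_le[OF B(2) False _ sparse]) (use E in auto)
    also have "\<dots> \<le> 4 powr r * (real k - 1) + 1"
      using B(3) k by (intro add_right_mono mult_left_mono) auto
    finally show ?thesis using cardF by simp
  qed
qed

lemma cut_rank_pos:
  assumes "finite X" "v \<in> X" "nbs G X v \<noteq> {}"
  shows "cut_rank G X \<ge> 1"
proof (rule ccontr)
  assume "\<not> ?thesis"
  moreover obtain B where B: "finite B" "card B \<le> cut_rank G X"
    and inj: "inj_on (\<lambda>N. N \<inter> B) (insert {} (nbs G X ` X))"
    using separating_columns[OF assms(1)] by metis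
  ultimately have "card B = 0" by linarith
  then have "B = {}" using B(1) by simp
  then show False using inj_onD[OF inj, of "nbs G X v" "{}"] assms by auto
qed

section \<open>From rank-decompositions to binary branchings\<close>

text \<open>The rooted form of a rank-decomposition: \<open>branching P X\<close> means that \<open>X\<close> can be assembled from
singletons by binary disjoint unions, all sets on the way satisfying \<open>P\<close>.\<close>

inductive branching :: "('a set \<Rightarrow> bool) \<Rightarrow> 'a set \<Rightarrow> bool" for P where
  single: "P {v} \<Longrightarrow> branching P {v}"
| merge: "branching P X \<Longrightarrow> branching P Y \<Longrightarrow> X \<inter> Y = {} \<Longrightarrow> P (X \<union> Y) \<Longrightarrow> branching P (X \<union> Y)"

lemma branching_mono:
  assumes "branching P X" "\<And>Y. P Y \<Longrightarrow> Q Y"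
  shows "branching Q X"
  using assms(1) by induction (auto intro: branching.intros assms(2))

lemma branching_holds: "branching P X \<Longrightarrow> P X"
  by (induction rule: branching.induct)

lemma branching_singleton:
  assumes "branching P X" "v \<in> X"
  shows "P {v}"
  using assms by (induction rule: branching.induct) auto

text \<open>The component of \<open>t\<close> in the graph that remains when the edge between \<open>t\<close> and \<open>u\<close> is removed.\<close>

definition branch :: "'a graph \<Rightarrow> 'a \<Rightarrow> 'a \<Rightarrow> 'a set" where
  "branch T t u = {v. (t, v) \<in> (adj (remove_edge T {t, u}))\<^sup>*}"

lemma branch_self: "t \<in> branch T t u" by (simp add: branch_def)

lemma branch_step:
  assumes "v \<in> branch T t u" "(v, w) \<in> adj T" "{v, w} \<noteq> {t, u}"
  shows "w \<in> branch T t u"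
proof -
  have "(v, w) \<in> adj (remove_edge T {t, u})" using assms by (auto simp: adj_def remove_edge_def)
  then show ?thesis using assms(1) unfolding branch_def by (auto intro: rtrancl_into_rtrancl)
qed

text \<open>An induction principle: a set that contains \<open>t\<close> and is closed under the steps inside the branch
contains the branch.\<close>

lemma branch_subset:
  assumes "t \<in> Y"
    and "\<And>v w. v \<in> Y \<Longrightarrow> v \<in> branch T t u \<Longrightarrow> (v, w) \<in> adj T \<Longrightarrow> {v, w} \<noteq> {t, u} \<Longrightarrow> w \<in> Y"
  shows "branch T t u \<subseteq> Y"
proof
  fix v assume "v \<in> branch T t u"
  then have "(t, v) \<in> (adj (remove_edge T {t, u}))\<^sup>*" by (simp add: branch_def)
  then show "v \<in> Y"
  proof (induction rule: rtrancl_induct)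
    case (step v w)
    have "(v, w) \<in> adj T" "{v, w} \<noteq> {t, u}"
      using step.hyps(2) by (auto simp: adj_def remove_edge_def)
    then show ?case using assms(2) step by (auto simp: branch_def)
  qed (rule assms(1))
qed

lemma tree_edge_adj:
  assumes "is_tree T" "{t, u} \<in> edges T"
  shows "t \<noteq> u" "(t, u) \<in> adj T" "(u, t) \<in> adj T" "t \<in> verts T" "u \<in> verts T"
  using assms simple_graph_edge[of T t u] by (auto simp: is_tree_def adj_def insert_commute)

lemma tree_branch_notin:
  assumes "is_tree T" "{t, u} \<in> edges T"
  shows "u \<notin> branch T t u"
  using assms by (simp add: is_tree_iff branch_def)

lemma tree_branches_disjoint:
  assumes T: "is_tree T" and e: "{a, t} \<in> edges T" "{b, t} \<in> edges T" and ab: "a \<noteq> b"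
  shows "branch T a t \<inter> branch T b t = {}"
proof -
  have tb: "t \<notin> branch T b t" using tree_branch_notin T e by metis
  \<comment> \<open>A walk avoiding \<open>t\<close> stays on its side of both edges, so a common vertex would
    join \<open>a\<close> to \<open>b\<close>, and hence to \<open>t\<close>, without the edge between \<open>a\<close> and \<open>t\<close>.\<close>
  have "v \<notin> branch T a t" if "v \<in> branch T b t" for v
  proof -
    have "branch T b t \<subseteq> {v. v \<in> branch T a t \<longleftrightarrow> b \<in> branch T a t}"
    proof (rule branch_subset)
      fix v w assume v: "v \<in> {v. v \<in> branch T a t \<longleftrightarrow> b \<in> branch T a t}" "v \<in> branch T b t"
        and vw: "(v, w) \<in> adj T" "{v, w} \<noteq> {b, t}"
      have "w \<in> branch T b t" using branch_step v(2) vw by metis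
      then have "v \<noteq> t" "w \<noteq> t" using tb v(2) by auto
      then have "{v, w} \<noteq> {a, t}" "{w, v} \<noteq> {a, t}" by (auto simp: doubleton_eq_iff)
      then have "v \<in> branch T a t \<longleftrightarrow> w \<in> branch T a t"
        using branch_step vw(1) adj_sym by metis
      then show "w \<in> {v. v \<in> branch T a t \<longleftrightarrow> b \<in> branch T a t}" using v(1) by simp
    qed simp
    then have "v \<in> branch T a t \<longleftrightarrow> b \<in> branch T a t" using that by blast
    moreover have "b \<notin> branch T a t"
    proof
      assume "b \<in> branch T a t"
      moreover have "(b, t) \<in> adj T" using tree_edge_adj[OF T e(2)] by simp
      moreover have "{b, t} \<noteq> {a, t}" using ab by (auto simp: doubleton_eq_iff)
      ultimately have "t \<in> branch T a t" by (rule branch_step)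
      then show False using tree_branch_notin[OF T e(1)] by simp
    qed
    ultimately show ?thesis by simp
  qed
  then show ?thesis by blast
qed

text \<open>This is the recursion along which the tree is turned into a branching: the branch at \<open>t\<close> consists
of \<open>t\<close> and the branches at the other neighbours of \<open>t\<close>.\<close>

lemma tree_branch_expand:
  assumes T: "is_tree T" and e: "{t, u} \<in> edges T"
  shows "branch T t u = insert t (\<Union>a \<in> {a. {a, t} \<in> edges T \<and> a \<noteq> u}. branch T a t)"
    (is "_ = ?Y")
proof
  show "branch T t u \<subseteq> ?Y"
  proof (rule branch_subset)
    fix v w assume v: "v \<in> ?Y" and vw: "(v, w) \<in> adj T" "{v, w} \<noteq> {t, u}"
    show "w \<in> ?Y"
    proof (cases "v = t \<or> w = t")
      case True
      then show ?thesis
      proof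
        assume "v = t"
        then have "{w, t} \<in> edges T" "w \<noteq> u" using vw by (auto simp: adj_def insert_commute)
        then show ?thesis using branch_self[of w T t] by blast
      qed simp
    next
      case False
      then obtain a where a: "{a, t} \<in> edges T" "a \<noteq> u" "v \<in> branch T a t" using v by blast
      have "w \<in> branch T a t"
        using branch_step[OF a(3) vw(1)] False by (auto simp: doubleton_eq_iff)
      then show ?thesis using a by blast
    qed
  qed simp
  have "branch T a t \<subseteq> branch T t u" if a: "{a, t} \<in> edges T" "a \<noteq> u" for a
  proof (rule branch_subset)
    have "{t, a} \<noteq> {t, u}" using a by (auto simp: doubleton_eq_iff)
    then show "a \<in> branch T t u"
      using branch_step[OF branch_self] tree_edge_adj(3)[OF T a(1)] by metis
    fix v w assume v: "v \<in> branch T t u" "v \<in> branch T a t" and vw: "(v, w) \<in> adj T" "{v, w} \<noteq> {a, t}"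
    have "w \<in> branch T a t" using branch_step v(2) vw by metis
    then have "v \<noteq> t" "w \<noteq> t" using v(2) tree_branch_notin[OF T a(1)] by auto
    then have "{v, w} \<noteq> {t, u}" by (auto simp: doubleton_eq_iff)
    then show "w \<in> branch T t u" using branch_step v(1) vw(1) by metis
  qed
  then show "?Y \<subseteq> branch T t u" using branch_self[of t T u] by blast
qed

lemma tree_branches_cover:
  assumes T: "is_tree T" and e: "{t, u} \<in> edges T"
  shows "verts T = branch T t u \<union> branch T u t"
proof
  have sub: "branch T x y \<subseteq> verts T" if "x \<in> verts T" for x y
    by (rule branch_subset) (use that in \<open>auto simp: adj_def\<close>)
  show "branch T t u \<union> branch T u t \<subseteq> verts T" using sub tree_edge_adj[OF T e] by blast
  show "verts T \<subseteq> branch T t u \<union> branch T u t"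
  proof
    fix v assume "v \<in> verts T"
    then have "(t, v) \<in> (adj T)\<^sup>*"
      using T tree_edge_adj(4)[OF T e] by (simp add: is_tree_iff connected_graph_iff)
    then show "v \<in> branch T t u \<union> branch T u t"
    proof (induction rule: rtrancl_induct)
      case base
      show ?case by (simp add: branch_self)
    next
      case (step v w)
      show ?case
      proof (cases "{v, w} = {t, u}")
        case True
        then have "w = t \<or> w = u" by (auto simp: doubleton_eq_iff)
        then show ?thesis by (auto simp: branch_self)
      next
        case False
        then have "{v, w} \<noteq> {u, t}" by (simp add: insert_commute)
        then show ?thesis
          using step.IH False branch_step[of v T t u w] branch_step[of v T u t w] step.hyps(2)
          by blast
      qed
    qed
  qed
qed

lemma degree_eq_card_nbrs:
  assumes "simple_graph T"
  shows "degree T t = card {a. {a, t} \<in> edges T}"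
proof -
  have "(\<lambda>a. {a, t}) ` {a. {a, t} \<in> edges T} = {e \<in> edges T. t \<in> e}" (is "?L = ?R")
  proof
    show "?R \<subseteq> ?L"
    proof
      fix e assume e: "e \<in> ?R"
      then have "card e = 2" using assms by (auto simp: simple_graph_def)
      then obtain a where "e = {a, t}" using e by (auto simp: card_2_iff insert_commute)
      then show "e \<in> ?L" using e by blast
    qed
  qed auto
  moreover have "card ((\<lambda>a. {a, t}) ` {a. {a, t} \<in> edges T}) = card {a. {a, t} \<in> edges T}"
    by (rule card_image) (auto simp: inj_on_def doubleton_eq_iff)
  ultimately show ?thesis by (simp add: degree_def)
qed

lemma finite_rd_width_set:
  assumes "simple_graph T"
  shows "finite {cut_rank G {v \<in> verts G. \<mu> v \<in> C} | e C. e \<in> edges T \<and> C \<in> components (remove_edge T e)}"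
proof -
  have "{cut_rank G {v \<in> verts G. \<mu> v \<in> C} | e C. e \<in> edges T \<and> C \<in> components (remove_edge T e)}
    = (\<Union>e\<in>edges T. (\<lambda>C. cut_rank G {v \<in> verts G. \<mu> v \<in> C}) ` components (remove_edge T e))" by blast
  moreover have "finite (components (remove_edge T e))" for e
    using assms by (simp add: components_def remove_edge_def simple_graph_def)
  ultimately show ?thesis using simple_graph_finite_edges[OF assms] by simp
qed

lemma branch_cut_rank_le:
  assumes T: "is_tree T" and e: "{t, u} \<in> edges T"
  shows "cut_rank G {v \<in> verts G. \<mu> v \<in> branch T t u} \<le> rd_width G T \<mu>"
proof -
  have "t \<in> verts (remove_edge T {t, u})"
    using tree_edge_adj(4)[OF T e] by (simp add: remove_edge_def)
  then have "branch T t u \<in> components (remove_edge T {t, u})"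
    unfolding components_def branch_def ex_walk_iff by (auto intro!: image_eqI[of _ _ t])
  then show ?thesis
    unfolding rd_width_def using e T
    by (intro Max_ge finite_rd_width_set) (auto simp: is_tree_def)
qed

text \<open>A leaf carries a single vertex of \<open>G\<close>. An inner node carries none, and two of its three neighbours
lie beyond the edge by which it is entered, so the vertices of its branch split into those of two
smaller branches.\<close>

lemma branching_of_branch:
  assumes T: "ternary_tree T" and \<mu>: "bij_betw \<mu> (verts G) (leaves T)"
    and e: "{t, u} \<in> edges T"
  shows "branching (\<lambda>X. X \<subseteq> verts G \<and> cut_rank G X \<le> rd_width G T \<mu>)
    {v \<in> verts G. \<mu> v \<in> branch T t u}"
  using e
proof (induction "card (branch T t u)" arbitrary: t u rule: less_induct)
  case less
  note e = less.prems
  let ?P = "\<lambda>X. X \<subseteq> verts G \<and> cut_rank G X \<le> rd_width G T \<mu>"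
  let ?pre = "\<lambda>C. {v \<in> verts G. \<mu> v \<in> C}"
  have tree: "is_tree T" and simple: "simple_graph T"
    using T by (auto simp: ternary_tree_def is_tree_def)
  have t: "t \<in> verts T" using tree_edge_adj[OF tree e] by simp
  let ?N = "{a. {a, t} \<in> edges T \<and> a \<noteq> u}"
  have finN: "finite {a. {a, t} \<in> edges T}"
  proof (rule finite_subset)
    show "{a. {a, t} \<in> edges T} \<subseteq> verts T" using tree_edge_adj(4)[OF tree] by blast
    show "finite (verts T)" using simple by (simp add: simple_graph_def)
  qed
  have "card ?N = degree T t - 1"
  proof -
    have "?N = {a. {a, t} \<in> edges T} - {u}" by auto
    then show ?thesis
      using e by (simp add: degree_eq_card_nbrs[OF simple] card_Diff_singleton insert_commute)
  qed
  moreover have "degree T t = 1 \<or> degree T t = 3" using T t by (simp add: ternary_tree_def)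
  ultimately consider "degree T t = 1" "card ?N = 0" | "degree T t = 3" "card ?N = 2" by force
  then show ?case
  proof cases
    case 1
    have "finite ?N" using finN by (rule finite_subset[rotated]) auto
    then have "?N = {}" using 1(2) by simp
    then have br: "branch T t u = {t}"
      by (simp only: tree_branch_expand[OF tree e] UN_empty)
    have "t \<in> leaves T" using 1 t by (simp add: leaves_def)
    then have "t \<in> \<mu> ` verts G" using \<mu> by (simp add: bij_betw_def)
    then obtain v where v: "v \<in> verts G" "\<mu> v = t" by blast
    then have pre: "?pre {t} = {v}" using \<mu> by (auto simp: bij_betw_def inj_on_def)
    have "?P (?pre (branch T t u))" using branch_cut_rank_le[OF tree e] by auto
    then have "?P {v}" unfolding br pre .
    then show ?thesis unfolding br pre by (rule branching.single)
  next
    case 2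
    then obtain a b where N: "?N = {a, b}" and ab: "a \<noteq> b" by (auto simp: card_2_iff)
    then have "a \<in> ?N" "b \<in> ?N" by simp_all
    then have ea: "{a, t} \<in> edges T" and eb: "{b, t} \<in> edges T" by simp_all
    have br: "branch T t u = insert t (branch T a t \<union> branch T b t)"
      by (simp only: tree_branch_expand[OF tree e] N) simp
    have fin: "finite (branch T t u)"
      using tree_branches_cover[OF tree e] simple by (metis finite_Un simple_graph_def)
    have "t \<notin> branch T a t" "t \<notin> branch T b t" using tree_branch_notin[OF tree] ea eb by blast+
    then have "branch T a t \<subset> branch T t u" "branch T b t \<subset> branch T t u" using br by blast+
    then have "card (branch T a t) < card (branch T t u)" "card (branch T b t) < card (branch T t u)"
      using psubset_card_mono[OF fin] by blast+
    then have IH: "branching ?P (?pre (branch T a t))" "branching ?P (?pre (branch T b t))"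
      using less.hyps ea eb by blast+
    have "t \<notin> leaves T" using 2 by (simp add: leaves_def)
    then have "\<mu> v \<noteq> t" if "v \<in> verts G" for v using \<mu> that by (auto simp: bij_betw_def)
    then have eq: "?pre (branch T t u) = ?pre (branch T a t) \<union> ?pre (branch T b t)"
      unfolding br by auto
    have "branching ?P (?pre (branch T a t) \<union> ?pre (branch T b t))"
    proof (rule branching.merge[OF IH])
      show "?pre (branch T a t) \<inter> ?pre (branch T b t) = {}"
        using tree_branches_disjoint[OF tree ea eb ab] by blast
      show "?P (?pre (branch T a t) \<union> ?pre (branch T b t))"
        using branch_cut_rank_le[OF tree e, of G \<mu>] unfolding eq by auto
    qed
    then show ?thesis using eq by simp
  qed
qed

lemma cut_rank_verts: "finite (verts G) \<Longrightarrow> cut_rank G (verts G) = 0"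
proof -
  have "cut_row G (verts G) = (\<lambda>_. 0)" by (auto simp: cut_row_def fun_eq_iff)
  then have "cut_row G (verts G) ` verts G \<subseteq> gf2.span {}" by auto
  then have "gf2.dim (cut_row G (verts G) ` verts G) \<le> card ({} :: ('a \<Rightarrow> bit) set)"
    by (rule gf2.dim_le_card) simp
  then show ?thesis by (simp add: cut_rank_def)
qed

lemma branching_of_rankwidth:
  assumes G: "simple_graph G" and card: "card (verts G) \<ge> 2"
  shows "branching (\<lambda>X. X \<subseteq> verts G \<and> cut_rank G X \<le> rankwidth G) (verts G)"
proof -
  obtain T0 :: "nat graph" where T0: "ternary_tree T0" "card (leaves T0) = card (verts G)"
    using ternary_tree_exists[OF card] by blast
  have fin: "finite (verts G)" using G by (simp add: simple_graph_def)
  have "finite (leaves T0)" using T0(2) card by (metis card.infinite not_numeral_le_zero)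
  then obtain \<mu>0 where "bij_betw \<mu>0 (verts G) (leaves T0)"
    using finite_same_card_bij[OF fin] T0(2) by metis
  then have "\<exists>w T \<mu>. rank_decomposition G T \<mu> \<and> rd_width G T \<mu> = w"
    using T0 by (auto simp: rank_decomposition_def)
  then have "\<exists>T \<mu>. rank_decomposition G T \<mu> \<and>
      rd_width G T \<mu> = (LEAST w. \<exists>T \<mu>. rank_decomposition G T \<mu> \<and> rd_width G T \<mu> = w)"
    by (rule LeastI_ex)
  then obtain T \<mu> where T: "ternary_tree T" and \<mu>: "bij_betw \<mu> (verts G) (leaves T)"
    and w: "rd_width G T \<mu> = rankwidth G"
    using card by (auto simp: rank_decomposition_def rankwidth_def)
  have tree: "is_tree T" using T by (simp add: ternary_tree_def)
  have "verts G \<noteq> {}" using card by auto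
  then obtain t where "t \<in> leaves T" using \<mu> by (auto simp: bij_betw_def)
  then have "degree T t = 1" by (simp add: leaves_def)
  then have "{a. {a, t} \<in> edges T} \<noteq> {}"
    using tree by (metis card.empty degree_eq_card_nbrs is_tree_def zero_neq_one)
  then obtain u where e: "{u, t} \<in> edges T" by blast
  then have e': "{t, u} \<in> edges T" by (simp add: insert_commute)
  let ?P = "\<lambda>X. X \<subseteq> verts G \<and> cut_rank G X \<le> rd_width G T \<mu>"
  let ?pre = "\<lambda>C. {v \<in> verts G. \<mu> v \<in> C}"
  have "\<mu> v \<in> verts T" if "v \<in> verts G" for v using \<mu> that by (auto simp: bij_betw_def leaves_def)
  then have eq: "?pre (branch T t u) \<union> ?pre (branch T u t) = verts G"
    using tree_branches_cover[OF tree e'] by auto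
  have "branching ?P (?pre (branch T t u) \<union> ?pre (branch T u t))"
  proof (rule branching.merge)
    show "branching ?P (?pre (branch T t u))" "branching ?P (?pre (branch T u t))"
      using branching_of_branch[OF T \<mu>] e e' by blast+
    have "v \<notin> branch T u t" if "v \<in> branch T t u" for v
    proof -
      have "branch T t u \<subseteq> - branch T u t"
      proof (rule branch_subset)
        show "t \<in> - branch T u t" using tree_branch_notin[OF tree e] by simp
        fix v w assume "v \<in> - branch T u t" and vw: "(v, w) \<in> adj T" "{v, w} \<noteq> {t, u}"
        moreover have "{w, v} \<noteq> {u, t}" using vw(2) by (simp add: insert_commute)
        ultimately show "w \<in> - branch T u t"
          using branch_step[of w T u t v] adj_sym[OF vw(1)] by blast
      qed
      then show ?thesis using that by blast
    qed
    then show "?pre (branch T t u) \<inter> ?pre (branch T u t) = {}" by blast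
    show "?P (?pre (branch T t u) \<union> ?pre (branch T u t))"
      unfolding eq using cut_rank_verts[OF fin] by simp
  qed
  then show ?thesis using eq w by simp
qed

section \<open>Clique-width of a branching with sparse cuts\<close>

text \<open>The function \<open>c\<close> is the partition into classes that the new labels have to respect, \<open>z\<close> is a label
reserved for the class \<open>c0\<close>, and \<open>L\<close> is the range into which all other labels have to be moved. One
cannot apply a given permutation of labels without a spare label; but here a label outside \<open>L\<close> can
move to an unused element of \<open>L\<close>, and if there is none then by counting two labels carry the same
class and can be merged, or some label carries \<open>c0\<close> and can be merged into \<open>z\<close>. The measure counts
the used labels other than \<open>z\<close>, and again those of them outside \<open>L\<close>.\<close>

lemma normalize_labels:
  assumes "k_expr K t" "finite (expr_verts t)" and z: "z \<in> {1..K}" and L: "L \<subseteq> {1..K} - {z}"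
    and "\<And>v w. v \<in> expr_verts t \<Longrightarrow> w \<in> expr_verts t \<Longrightarrow> expr_lab t v = expr_lab t w \<Longrightarrow> c v = c w"
    and "\<And>v. v \<in> expr_verts t \<Longrightarrow> expr_lab t v = z \<Longrightarrow> c v = c0"
    and "\<And>v. v \<in> expr_verts t \<Longrightarrow> expr_lab t v \<in> {1..K}"
    and "card (c ` expr_verts t - {c0}) \<le> card L"
  shows "\<exists>t'. k_expr K t' \<and> expr_verts t' = expr_verts t \<and> expr_edges t' = expr_edges t \<and>
    (\<forall>v\<in>expr_verts t. expr_lab t' v \<in> insert z L \<and> (expr_lab t' v = z \<longrightarrow> c v = c0)) \<and>
    (\<forall>v\<in>expr_verts t. \<forall>w\<in>expr_verts t. expr_lab t' v = expr_lab t' w \<longrightarrow> c v = c w)"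
  using assms(1,2,5-8)
proof (induction "card (expr_lab t ` expr_verts t - {z}) + card (expr_lab t ` expr_verts t - {z} - L)"
    arbitrary: t rule: less_induct)
  case less
  let ?V = "expr_verts t" and ?U = "\<lambda>t. expr_lab t ` expr_verts t - {z}"
  note fin = less.prems(2) and same = less.prems(3) and zero = less.prems(4)
    and range = less.prems(5) and small = less.prems(6)
  have finU: "finite (?U t)" using fin by simp
  have finL: "finite L" using L by (rule finite_subset) simp
  have relabel: ?case
    if i: "i \<in> ?U t" and j: "j \<in> {1..K}" "i \<noteq> j"
      and c: "\<And>v w. v \<in> ?V \<Longrightarrow> w \<in> ?V \<Longrightarrow> expr_lab t v = i \<Longrightarrow> expr_lab t w = j \<Longrightarrow> c v = c w"
        "\<And>v. v \<in> ?V \<Longrightarrow> expr_lab t v = i \<Longrightarrow> j = z \<Longrightarrow> c v = c0"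
      and dec: "card (?U (Relabel i j t)) + card (?U (Relabel i j t) - L) < card (?U t) + card (?U t - L)"
    for i j
  proof -
    have iK: "i \<in> {1..K}" using i range by auto
    have "\<exists>t'. k_expr K t' \<and> expr_verts t' = expr_verts (Relabel i j t) \<and>
      expr_edges t' = expr_edges (Relabel i j t) \<and>
      (\<forall>v\<in>expr_verts (Relabel i j t). expr_lab t' v \<in> insert z L \<and> (expr_lab t' v = z \<longrightarrow> c v = c0)) \<and>
      (\<forall>v\<in>expr_verts (Relabel i j t). \<forall>w\<in>expr_verts (Relabel i j t).
        expr_lab t' v = expr_lab t' w \<longrightarrow> c v = c w)"
    proof (rule less.hyps[OF dec])
      show "k_expr K (Relabel i j t)" using less.prems(1) iK j by simp
      show "finite (expr_verts (Relabel i j t))" using fin by simp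
      show "c v = c w" if "v \<in> expr_verts (Relabel i j t)" "w \<in> expr_verts (Relabel i j t)"
        "expr_lab (Relabel i j t) v = expr_lab (Relabel i j t) w" for v w
      proof -
        have vw: "v \<in> ?V" "w \<in> ?V" using that by simp_all
        have "(if expr_lab t v = i then j else expr_lab t v) =
            (if expr_lab t w = i then j else expr_lab t w)" using that(3) by simp
        then consider "expr_lab t v = expr_lab t w" | "expr_lab t v = i" "expr_lab t w = j"
          | "expr_lab t w = i" "expr_lab t v = j" by (auto split: if_splits)
        then show ?thesis
        proof cases
          case 1
          then show ?thesis by (rule same[OF vw])
        next
          case 2
          then show ?thesis by (rule c(1)[OF vw])
        next
          case 3
          then show ?thesis by (rule c(1)[OF vw(2,1), symmetric])
        qed
      qed
      show "c v = c0" if "v \<in> expr_verts (Relabel i j t)" "expr_lab (Relabel i j t) v = z" for v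
        using that zero[of v] c(2)[of v] by (auto split: if_splits)
      show "expr_lab (Relabel i j t) v \<in> {1..K}" if "v \<in> expr_verts (Relabel i j t)" for v
        using that range[of v] j by auto
      show "card (c ` expr_verts (Relabel i j t) - {c0}) \<le> card L" using small by simp
    qed
    then show ?thesis by simp
  qed
  have U_relabel: "?U (Relabel i j t) = ?U t - {i} \<union> ({j} - {z})" if "i \<in> ?U t" "i \<noteq> j" for i j
    using that by (auto simp: image_iff)
  \<comment> \<open>Identifying a label with \<open>z\<close> or with another used label lowers the first summand.\<close>
  have merge: ?case
    if i: "i \<in> ?U t" and j: "j = z \<or> j \<in> ?U t" "i \<noteq> j"
      and c: "\<And>v w. v \<in> ?V \<Longrightarrow> w \<in> ?V \<Longrightarrow> expr_lab t v = i \<Longrightarrow> expr_lab t w = j \<Longrightarrow> c v = c w"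
        "\<And>v. v \<in> ?V \<Longrightarrow> expr_lab t v = i \<Longrightarrow> j = z \<Longrightarrow> c v = c0" for i j
  proof (rule relabel[OF i _ j(2) c])
    show "j \<in> {1..K}" using j(1) z range by auto
    have eq: "?U (Relabel i j t) = ?U t - {i}" using U_relabel[OF i j(2)] j by auto
    have "card (?U t - {i}) < card (?U t)" using finU i by (rule card_Diff1_less)
    moreover have "card (?U t - {i} - L) \<le> card (?U t - L)" using finU by (intro card_mono) auto
    ultimately show "card (?U (Relabel i j t)) + card (?U (Relabel i j t) - L)
        < card (?U t) + card (?U t - L)" unfolding eq by linarith
  qed
  show ?case
  proof (cases "?U t \<subseteq> L")
    case True
    show ?thesis
    proof (intro exI[of _ t] conjI ballI impI refl less.prems(1))
      show "expr_lab t v \<in> insert z L" if "v \<in> ?V" for v using True that by auto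
    qed (fact zero same)+
  next
    case False
    then obtain i where i: "i \<in> ?U t" "i \<notin> L" by blast
    show ?thesis
    proof (cases "\<exists>j\<in>L. j \<notin> ?U t")
      case True
      then obtain j where j: "j \<in> L" "j \<notin> ?U t" by blast
      have jz: "j \<noteq> z" "j \<in> {1..K}" "i \<noteq> j" using j L i by auto
      have unused: "expr_lab t w \<noteq> j" if "w \<in> ?V" for w using that j jz by auto
      show ?thesis
      proof (rule relabel[OF i(1) jz(2,3)])
        have eq: "?U (Relabel i j t) = insert j (?U t - {i})" using U_relabel[OF i(1) jz(3)] jz by auto
        have c1: "card (insert j (?U t - {i})) = card (?U t)"
          using finU i(1) j by (metis Diff_iff card.insert card.remove finite_Diff)
        have "insert j (?U t - {i}) - L = ?U t - L - {i}" using j by auto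
        moreover have "card (?U t - L - {i}) < card (?U t - L)"
          using finU i by (intro card_Diff1_less) auto
        ultimately have "card (insert j (?U t - {i}) - L) < card (?U t - L)" by (simp only:)
        then show "card (?U (Relabel i j t)) + card (?U (Relabel i j t) - L)
            < card (?U t) + card (?U t - L)" unfolding eq c1 by linarith
      qed (use unused jz in auto)
    next
      case False
      \<comment> \<open>All of \<open>L\<close> is in use, and \<open>i\<close> besides: two of these labels carry the
        same class, or one of them carries \<open>c0\<close>.\<close>
      then have "insert i L \<subseteq> ?U t" using i by blast
      then have "card (insert i L) \<le> card (?U t)" by (rule card_mono[OF finU])
      then have big: "card L < card (?U t)" using i finL by simp
      define w where "w = inv_into ?V (expr_lab t)"
      have w: "w l \<in> ?V" "expr_lab t (w l) = l" if "l \<in> ?U t" for l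
        using that by (auto simp: w_def inv_into_into f_inv_into_f)
      have cls: "c v = c (w l)" if "v \<in> ?V" "expr_lab t v = l" "l \<in> ?U t" for v l
        using same[of v "w l"] w[of l] that by simp
      show ?thesis
      proof (cases "\<exists>l\<in>?U t. c (w l) = c0")
        case True
        then obtain l where l: "l \<in> ?U t" "c (w l) = c0" by blast
        show ?thesis by (rule merge[OF l(1), of z]) (use l cls zero in auto)
      next
        case no: False
        have "\<not> inj_on (\<lambda>l. c (w l)) (?U t)"
        proof
          assume "inj_on (\<lambda>l. c (w l)) (?U t)"
          then have "card (?U t) = card ((\<lambda>l. c (w l)) ` ?U t)" by (simp add: card_image)
          also have "\<dots> \<le> card (c ` ?V - {c0})"
            using fin w no by (intro card_mono) auto
          finally show False using big small by linarith
        qed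
        then obtain l j where lj: "l \<in> ?U t" "j \<in> ?U t" "c (w l) = c (w j)" "l \<noteq> j"
          by (auto simp: inj_on_def)
        have cj: "c v = c x" if "v \<in> ?V" "x \<in> ?V" "expr_lab t v = l" "expr_lab t x = j" for v x
          using cls[of v l] cls[of x j] that lj by simp
        show ?thesis
        proof (rule merge[OF lj(1) disjI2[OF lj(2)] lj(4) cj])
          show "c v = c0" if "j = z" for v using lj(2) that by simp
        qed
      qed
    qed
  qed
qed

lemma join_label_pairs:
  assumes "finite Q" "k_expr K t" "\<And>i j. (i, j) \<in> Q \<Longrightarrow> i \<in> {1..K} \<and> j \<in> {1..K} \<and> i \<noteq> j"
  shows "\<exists>t'. k_expr K t' \<and> expr_verts t' = expr_verts t \<and> expr_lab t' = expr_lab t \<and>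
    expr_edges t' = expr_edges t \<union>
      {{u, v} | u v. u \<in> expr_verts t \<and> v \<in> expr_verts t \<and> (expr_lab t u, expr_lab t v) \<in> Q}"
  using assms(1,3)
proof (induction Q)
  case empty
  then show ?case using assms(2) by (intro exI[of _ t]) auto
next
  case (insert q Q)
  have "\<exists>t'. k_expr K t' \<and> expr_verts t' = expr_verts t \<and> expr_lab t' = expr_lab t \<and>
    expr_edges t' = expr_edges t \<union>
      {{u, v} | u v. u \<in> expr_verts t \<and> v \<in> expr_verts t \<and> (expr_lab t u, expr_lab t v) \<in> Q}"
    using insert.prems by (intro insert.IH) blast
  then obtain t' where t': "k_expr K t'" "expr_verts t' = expr_verts t" "expr_lab t' = expr_lab t"
    "expr_edges t' = expr_edges t \<union>
      {{u, v} | u v. u \<in> expr_verts t \<and> v \<in> expr_verts t \<and> (expr_lab t u, expr_lab t v) \<in> Q}"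
    by (elim exE conjE)
  obtain i j where q: "q = (i, j)" by (cases q)
  have "k_expr K (Join i j t')" using t' insert.prems[of i j] q by simp
  moreover have "expr_edges (Join i j t') = expr_edges t \<union>
      {{u, v} | u v. u \<in> expr_verts t \<and> v \<in> expr_verts t \<and> (expr_lab t u, expr_lab t v) \<in> insert q Q}"
    unfolding q expr_edges.simps t'(2-4) by blast
  ultimately show ?case using t'(2,3) by (intro exI[of _ "Join i j t'"] conjI) simp_all
qed

definition sparse_cut :: "'a graph \<Rightarrow> nat \<Rightarrow> 'a set \<Rightarrow> bool" where
  "sparse_cut G m X \<longleftrightarrow> X \<subseteq> verts G \<and> card (nbs G X ` X - {{}}) \<le> m"

text \<open>In a merge the labels of the second expression are first moved to \<open>{m+1..2*m}\<close>, so that labels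
of the two sides do not interfere. Equal labels mean equal neighbourhoods outside; therefore joining
every pair of labels that some edge demands creates no edge that is not in \<open>G\<close>. Passing to the union
only coarsens the classes, and there are again at most \<open>m\<close> nonempty neighbourhoods, so the labels can
be moved back to \<open>{1..m}\<close>. The label \<open>2 * m + 1\<close> is shared by both sides because its vertices have
no neighbours outside.\<close>

lemma expression_of_branching:
  assumes G: "simple_graph G" and m: "m \<ge> 1" and br: "branching (sparse_cut G m) X"
  shows "\<exists>t. k_expr (2 * m + 1) t \<and> expr_verts t = X \<and> expr_edges t = {e \<in> edges G. e \<subseteq> X} \<and>
    (\<forall>v\<in>X. expr_lab t v \<in> insert (2 * m + 1) {1..m} \<and> (expr_lab t v = 2 * m + 1 \<longrightarrow> nbs G X v = {})) \<and>
    (\<forall>v\<in>X. \<forall>w\<in>X. expr_lab t v = expr_lab t w \<longrightarrow> nbs G X v = nbs G X w)"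
  using br
proof induction
  case (single v)
  let ?t = "Single v (if nbs G {v} v = {} then 2 * m + 1 else 1)"
  have "{e \<in> edges G. e \<subseteq> {v}} = {}"
  proof -
    have False if "e \<in> edges G" "e \<subseteq> {v}" for e
      using that G card_mono[of "{v}" e] by (auto simp: simple_graph_def)
    then show ?thesis by blast
  qed
  then show ?case using m by (intro exI[of _ ?t]) auto
next
  case (merge X Y)
  let ?z = "2 * m + 1" let ?K = "2 * m + 1" let ?Z = "X \<union> Y"
  have sc: "sparse_cut G m X" "sparse_cut G m Y" "sparse_cut G m ?Z"
    using merge.hyps branching_holds by blast+
  have fin: "finite X" "finite Y"
    using sc G by (meson finite_subset simple_graph_def sparse_cut_def)+
  obtain s where s: "k_expr ?K s" "expr_verts s = X" "expr_edges s = {e \<in> edges G. e \<subseteq> X}"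
    "\<And>v. v \<in> X \<Longrightarrow> expr_lab s v \<in> insert ?z {1..m}"
    "\<And>v. v \<in> X \<Longrightarrow> expr_lab s v = ?z \<Longrightarrow> nbs G X v = {}"
    "\<And>v w. v \<in> X \<Longrightarrow> w \<in> X \<Longrightarrow> expr_lab s v = expr_lab s w \<Longrightarrow> nbs G X v = nbs G X w"
    using merge.IH(1) by (elim exE conjE) (rule that; blast)
  obtain t0 where t0: "k_expr ?K t0" "expr_verts t0 = Y" "expr_edges t0 = {e \<in> edges G. e \<subseteq> Y}"
    "\<And>v. v \<in> Y \<Longrightarrow> expr_lab t0 v \<in> insert ?z {1..m}"
    "\<And>v. v \<in> Y \<Longrightarrow> expr_lab t0 v = ?z \<Longrightarrow> nbs G Y v = {}"
    "\<And>v w. v \<in> Y \<Longrightarrow> w \<in> Y \<Longrightarrow> expr_lab t0 v = expr_lab t0 w \<Longrightarrow> nbs G Y v = nbs G Y w"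
    using merge.IH(2) by (elim exE conjE) (rule that; blast)
  have "\<exists>t'. k_expr ?K t' \<and> expr_verts t' = expr_verts t0 \<and> expr_edges t' = expr_edges t0 \<and>
    (\<forall>v\<in>expr_verts t0. expr_lab t' v \<in> insert ?z {m+1..2*m} \<and> (expr_lab t' v = ?z \<longrightarrow> nbs G Y v = {})) \<and>
    (\<forall>v\<in>expr_verts t0. \<forall>w\<in>expr_verts t0. expr_lab t' v = expr_lab t' w \<longrightarrow> nbs G Y v = nbs G Y w)"
  proof (rule normalize_labels)
    show "expr_lab t0 v \<in> {1..?K}" if "v \<in> expr_verts t0" for v using t0(2) t0(4)[of v] that by auto
    show "card (nbs G Y ` expr_verts t0 - {{}}) \<le> card {m+1..2*m}"
      using sc(2) t0(2) by (simp add: sparse_cut_def)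
    show "nbs G Y v = nbs G Y w"
      if "v \<in> expr_verts t0" "w \<in> expr_verts t0" "expr_lab t0 v = expr_lab t0 w" for v w
      using t0(6) that unfolding t0(2) .
    show "nbs G Y v = {}" if "v \<in> expr_verts t0" "expr_lab t0 v = ?z" for v
      using t0(5) that unfolding t0(2) .
    show "finite (expr_verts t0)" using fin t0(2) by simp
  qed (use t0(1) in auto)
  then obtain t where t: "k_expr ?K t" "expr_verts t = Y" "expr_edges t = {e \<in> edges G. e \<subseteq> Y}"
    "\<And>v. v \<in> Y \<Longrightarrow> expr_lab t v \<in> insert ?z {m+1..2*m}"
    "\<And>v. v \<in> Y \<Longrightarrow> expr_lab t v = ?z \<Longrightarrow> nbs G Y v = {}"
    "\<And>v w. v \<in> Y \<Longrightarrow> w \<in> Y \<Longrightarrow> expr_lab t v = expr_lab t w \<Longrightarrow> nbs G Y v = nbs G Y w"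
    unfolding t0(2,3) by (elim exE conjE) (rule that; blast)
  \<comment> \<open>The pairs of labels that some edge between the two sides requires to be joined.\<close>
  define Q where "Q = {(i, j). i \<in> {1..m} \<and> j \<in> {m+1..2*m} \<and>
    (\<exists>x\<in>X. \<exists>y\<in>Y. expr_lab s x = i \<and> expr_lab t y = j \<and> {x, y} \<in> edges G)}"
  let ?d = "Disj_Union s t"
  have finQ: "finite Q" by (rule finite_subset[of _ "{1..m} \<times> {m+1..2*m}"]) (auto simp: Q_def)
  have kd: "k_expr ?K ?d" using s(1,2) t(1,2) merge.hyps by simp
  have labX: "expr_lab ?d v = expr_lab s v" if "v \<in> X" for v using that s(2) by simp
  have labY: "expr_lab ?d v = expr_lab t v" if "v \<in> Y" for v using that s(2) merge.hyps by auto
  have "\<exists>t'. k_expr ?K t' \<and> expr_verts t' = expr_verts ?d \<and> expr_lab t' = expr_lab ?d \<and>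
    expr_edges t' = expr_edges ?d \<union>
      {{u, v} | u v. u \<in> expr_verts ?d \<and> v \<in> expr_verts ?d \<and> (expr_lab ?d u, expr_lab ?d v) \<in> Q}"
    by (rule join_label_pairs[OF finQ kd]) (auto simp: Q_def)
  then obtain j where j: "k_expr ?K j" "expr_verts j = ?Z" "expr_lab j = expr_lab ?d"
    and ej: "expr_edges j = {e \<in> edges G. e \<subseteq> X} \<union> {e \<in> edges G. e \<subseteq> Y} \<union>
      {{u, v} | u v. u \<in> ?Z \<and> v \<in> ?Z \<and> (expr_lab ?d u, expr_lab ?d v) \<in> Q}"
    using s(2,3) t(2,3) by auto
  have V: "X \<subseteq> verts G" "Y \<subseteq> verts G" using sc by (auto simp: sparse_cut_def)
  have sideX: "v \<in> X" if "v \<in> ?Z" "expr_lab ?d v \<in> {1..m}" for v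
    using that labY[of v] t(4)[of v] by auto
  have sideY: "v \<in> Y" if "v \<in> ?Z" "expr_lab ?d v \<in> {m+1..2*m}" for v
    using that labX[of v] s(4)[of v] by auto
  \<comment> \<open>An edge between two classes extends to all pairs of their members, one side at a time.\<close>
  have cross: "(expr_lab s u, expr_lab t v) \<in> Q \<longleftrightarrow> {u, v} \<in> edges G" if uv: "u \<in> X" "v \<in> Y" for u v
  proof
    assume "(expr_lab s u, expr_lab t v) \<in> Q"
    then obtain x y where xy: "x \<in> X" "y \<in> Y" "expr_lab s x = expr_lab s u" "expr_lab t y = expr_lab t v"
      "{x, y} \<in> edges G" by (auto simp: Q_def)
    have "y \<in> nbs G X x" using xy V merge.hyps(3) by (auto simp: nbs_def)
    then have "y \<in> nbs G X u" using s(6)[of x u] xy uv by simp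
    then have "u \<in> nbs G Y y" using uv V merge.hyps(3) by (auto simp: nbs_def insert_commute)
    then have "u \<in> nbs G Y v" using t(6)[of y v] xy uv by simp
    then show "{u, v} \<in> edges G" by (simp add: nbs_def insert_commute)
  next
    assume e: "{u, v} \<in> edges G"
    have "v \<in> nbs G X u" "u \<in> nbs G Y v"
      using e uv V merge.hyps(3) by (auto simp: nbs_def insert_commute)
    then have "expr_lab s u \<noteq> ?z" "expr_lab t v \<noteq> ?z" using s(5)[of u] t(5)[of v] uv by auto
    then show "(expr_lab s u, expr_lab t v) \<in> Q"
      using s(4)[of u] t(4)[of v] uv e by (auto simp: Q_def)
  qed
  have edges: "expr_edges j = {e \<in> edges G. e \<subseteq> ?Z}"
  proof
    show "expr_edges j \<subseteq> {e \<in> edges G. e \<subseteq> ?Z}"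
    proof
      fix e assume "e \<in> expr_edges j"
      then consider "e \<in> edges G" "e \<subseteq> X \<or> e \<subseteq> Y"
        | u v where "e = {u, v}" "u \<in> ?Z" "v \<in> ?Z" "(expr_lab ?d u, expr_lab ?d v) \<in> Q"
        using ej by blast
      then show "e \<in> {e \<in> edges G. e \<subseteq> ?Z}"
      proof cases
        case 2
        have "u \<in> X" "v \<in> Y" using 2 sideX[of u] sideY[of v] by (auto simp: Q_def)
        then show ?thesis using cross[of u v] labX[of u] labY[of v] 2 by simp
      qed auto
    qed
    show "{e \<in> edges G. e \<subseteq> ?Z} \<subseteq> expr_edges j"
    proof
      fix e assume e: "e \<in> {e \<in> edges G. e \<subseteq> ?Z}"
      show "e \<in> expr_edges j"
      proof (cases "e \<subseteq> X \<or> e \<subseteq> Y")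
        case True
        then show ?thesis using e ej by blast
      next
        case False
        then obtain u v where uv: "u \<in> e" "u \<in> X" "v \<in> e" "v \<in> Y" "u \<noteq> v"
          using e merge.hyps(3) by blast
        have "card e = 2" using e G by (simp add: simple_graph_def)
        then have eq: "e = {u, v}" using uv by (auto simp: card_2_iff)
        then have "(expr_lab ?d u, expr_lab ?d v) \<in> Q"
          using cross[of u v] labX[of u] labY[of v] uv e by simp
        then show ?thesis using ej eq uv by blast
      qed
    qed
  qed
  have zero: "nbs G ?Z v = {}" if "v \<in> ?Z" "expr_lab j v = ?z" for v
  proof -
    have "v \<in> X \<or> v \<in> Y" using that by blast
    then show ?thesis
    proof
      assume v: "v \<in> X"
      then have "nbs G X v = {}" using s(5)[of v] that(2) labX[OF v] j(3) by simp
      then show ?thesis by (auto simp: nbs_def)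
    next
      assume v: "v \<in> Y"
      then have "nbs G Y v = {}" using t(5)[of v] that(2) labY[OF v] j(3) by simp
      then show ?thesis by (auto simp: nbs_def)
    qed
  qed
  have same: "nbs G ?Z v = nbs G ?Z w"
    if vw: "v \<in> ?Z" "w \<in> ?Z" "expr_lab j v = expr_lab j w" for v w
  proof -
    have mixed: "nbs G ?Z x = nbs G ?Z y" if xy: "x \<in> X" "y \<in> Y" "expr_lab j x = expr_lab j y" for x y
    proof -
      have "expr_lab j x = ?z"
        using xy s(4)[of x] t(4)[of y] labX[of x] labY[of y] j(3) by auto
      then show ?thesis using zero[of x] zero[of y] xy by simp
    qed
    consider "v \<in> X" "w \<in> X" | "v \<in> Y" "w \<in> Y" | "v \<in> X" "w \<in> Y" | "v \<in> Y" "w \<in> X" using vw by blast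
    then show ?thesis
    proof cases
      case 1
      then show ?thesis using s(6)[of v w] vw(3) labX[of v] labX[of w] j(3) by (simp add: nbs_subset_eq[of X ?Z])
    next
      case 2
      then show ?thesis using t(6)[of v w] vw(3) labY[of v] labY[of w] j(3) by (simp add: nbs_subset_eq[of Y ?Z])
    next
      case 3
      then show ?thesis using mixed vw(3) by blast
    next
      case 4
      then show ?thesis using mixed[of w v] vw(3) by simp
    qed
  qed
  have "\<exists>t'. k_expr ?K t' \<and> expr_verts t' = expr_verts j \<and> expr_edges t' = expr_edges j \<and>
    (\<forall>v\<in>expr_verts j. expr_lab t' v \<in> insert ?z {1..m} \<and> (expr_lab t' v = ?z \<longrightarrow> nbs G ?Z v = {})) \<and>
    (\<forall>v\<in>expr_verts j. \<forall>w\<in>expr_verts j. expr_lab t' v = expr_lab t' w \<longrightarrow> nbs G ?Z v = nbs G ?Z w)"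
  proof (rule normalize_labels)
    show "expr_lab j v \<in> {1..?K}" if "v \<in> expr_verts j" for v
    proof -
      have "v \<in> X \<or> v \<in> Y" using that j(2) by blast
      then show ?thesis
      proof
        assume v: "v \<in> X"
        then show ?thesis using s(4)[OF v] labX[OF v] j(3) by auto
      next
        assume v: "v \<in> Y"
        then show ?thesis using t(4)[OF v] labY[OF v] j(3) by auto
      qed
    qed
    show "card (nbs G ?Z ` expr_verts j - {{}}) \<le> card {1..m}"
      using sc(3) j(2) by (simp add: sparse_cut_def)
    show "finite (expr_verts j)" using fin j(2) by simp
    show "nbs G ?Z v = nbs G ?Z w"
      if "v \<in> expr_verts j" "w \<in> expr_verts j" "expr_lab j v = expr_lab j w" for v w
      using that same j(2) by blast
    show "nbs G ?Z v = {}" if "v \<in> expr_verts j" "expr_lab j v = ?z" for v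
      using that zero j(2) by blast
  qed (use j(1) in auto)
  then show ?case unfolding j(2) edges .
qed

section \<open>Tree-width of a branching with sparse cuts\<close>

text \<open>The sets \<open>A\<close> and \<open>C\<close> are automatically disjoint in a simple graph.\<close>

definition biclique_free :: "'a graph \<Rightarrow> nat \<Rightarrow> bool" where
  "biclique_free G d \<longleftrightarrow> (\<forall>A C. A \<subseteq> verts G \<longrightarrow> C \<subseteq> verts G \<longrightarrow>
     (\<forall>a\<in>A. \<forall>c\<in>C. {a, c} \<in> edges G) \<longrightarrow> card A \<le> d \<or> card C \<le> d)"

definition twins :: "'a graph \<Rightarrow> 'a set \<Rightarrow> 'a \<Rightarrow> 'a set" where
  "twins G X v = {w \<in> X. nbs G X w = nbs G X v}"

text \<open>A vertex cover of the edges between \<open>X\<close> and the rest: small classes of twins enter as they are,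
large ones are replaced by their common neighbourhood outside \<open>X\<close>.\<close>

definition cut_cover :: "'a graph \<Rightarrow> nat \<Rightarrow> 'a set \<Rightarrow> 'a set" where
  "cut_cover G d X =
     {v \<in> X. nbs G X v \<noteq> {} \<and> card (twins G X v) \<le> d} \<union>
     {w. \<exists>v\<in>X. w \<in> nbs G X v \<and> d < card (twins G X v)}"

lemma cut_cover_subset: "X \<subseteq> verts G \<Longrightarrow> cut_cover G d X \<subseteq> verts G"
  by (auto simp: cut_cover_def nbs_def)

lemma cut_cover_covers:
  assumes "{u, v} \<in> edges G" "u \<in> X" "v \<in> verts G - X"
  shows "u \<in> cut_cover G d X \<or> v \<in> cut_cover G d X"
proof -
  have "v \<in> nbs G X u" using assms by (simp add: nbs_def)
  then show ?thesis using assms(2) unfolding cut_cover_def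
    by (cases "card (twins G X u) \<le> d") auto
qed

text \<open>Each of the at most \<open>m\<close> nonempty neighbourhoods \<open>N\<close> contributes either its class or \<open>N\<close>. The two
are completely joined, so one of them has at most \<open>d\<close> elements, and the class is preferred.\<close>

lemma card_cut_cover_le:
  assumes G: "simple_graph G" and bf: "biclique_free G d" and X: "sparse_cut G m X"
  shows "card (cut_cover G d X) \<le> m * d"
proof -
  define part where "part N = (if card {w \<in> X. nbs G X w = N} \<le> d then {w \<in> X. nbs G X w = N} else N)" for N
  let ?R = "nbs G X ` X - {{}}"
  have XV: "X \<subseteq> verts G" and R: "card ?R \<le> m" using X by (auto simp: sparse_cut_def)
  have finV: "finite (verts G)" using G by (simp add: simple_graph_def)
  have finX: "finite X" using XV finV by (rule finite_subset)
  have "cut_cover G d X \<subseteq> (\<Union>N\<in>?R. part N)"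
  proof
    fix w assume "w \<in> cut_cover G d X"
    then consider "w \<in> X" "nbs G X w \<noteq> {}" "card (twins G X w) \<le> d"
      | v where "v \<in> X" "w \<in> nbs G X v" "d < card (twins G X v)"
      by (auto simp: cut_cover_def)
    then show "w \<in> (\<Union>N\<in>?R. part N)"
    proof cases
      case 1
      then have "w \<in> part (nbs G X w)" by (simp add: part_def twins_def)
      then show ?thesis using 1 by blast
    next
      case 2
      then have "w \<in> part (nbs G X v)" by (simp add: part_def twins_def)
      then show ?thesis using 2 by blast
    qed
  qed
  moreover have le: "card (part N) \<le> d" and fin: "finite (part N)" if "N \<in> ?R" for N
  proof -
    let ?C = "{w \<in> X. nbs G X w = N}"
    have NV: "N \<subseteq> verts G" using that by (auto simp: nbs_def)
    have "\<forall>a\<in>?C. \<forall>c\<in>N. {a, c} \<in> edges G" by (auto simp: nbs_def)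
    moreover have "?C \<subseteq> verts G" using XV by auto
    ultimately have "card ?C \<le> d \<or> card N \<le> d" using bf NV unfolding biclique_free_def by blast
    then show "card (part N) \<le> d" by (auto simp: part_def)
    show "finite (part N)" using finX finite_subset[OF NV finV] by (simp add: part_def)
  qed
  moreover have finR: "finite ?R" using finX by simp
  ultimately have "card (cut_cover G d X) \<le> card (\<Union>N\<in>?R. part N)"
    by (intro card_mono) auto
  also have "\<dots> \<le> (\<Sum>N\<in>?R. card (part N))" by (rule card_UN_le[OF finR])
  also have "\<dots> \<le> card ?R * d" using sum_bounded_above[of ?R "\<lambda>N. card (part N)" d] le by simp
  also have "\<dots> \<le> m * d" using R by (rule mult_le_mono1)
  finally show ?thesis .
qed

lemma twins_mono:
  assumes "X \<subseteq> Z"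
  shows "twins G X v \<subseteq> twins G Z v"
  using assms by (auto simp: twins_def nbs_subset_eq[OF assms])

text \<open>The next three lemmas make the bags that contain a vertex \<open>v\<close> connected: going from any cover
containing \<open>v\<close> towards the leaf of \<open>v\<close>, all covers on the way contain \<open>v\<close>. On the way down, classes
only get smaller; on the way up, larger; and where the path turns, \<open>v\<close> is joined to a large class on
the other side, so its own class must be small.\<close>

lemma cut_cover_shrink:
  assumes Z: "finite Z" "X \<subseteq> Z" and v: "v \<in> X" "v \<in> cut_cover G d Z"
  shows "v \<in> cut_cover G d X"
proof -
  have "nbs G Z v \<noteq> {}" "card (twins G Z v) \<le> d"
    using v Z(2) by (auto simp: cut_cover_def nbs_def)
  moreover have "card (twins G X v) \<le> card (twins G Z v)"
    by (rule card_mono[OF _ twins_mono[OF Z(2)]]) (use Z in \<open>auto simp: twins_def\<close>)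
  ultimately show ?thesis using v(1) nbs_subset_eq[OF Z(2), of G v] by (auto simp: cut_cover_def)
qed

lemma cut_cover_grow:
  assumes Z: "finite Z" "X \<subseteq> Z" and v: "v \<notin> Z" "v \<in> cut_cover G d X"
  shows "v \<in> cut_cover G d Z"
proof -
  obtain x where x: "x \<in> X" "v \<in> nbs G X x" "d < card (twins G X x)"
    using v Z(2) by (auto simp: cut_cover_def)
  have "card (twins G X x) \<le> card (twins G Z x)"
    by (rule card_mono[OF _ twins_mono[OF Z(2)]]) (use Z in \<open>auto simp: twins_def\<close>)
  moreover have "v \<in> nbs G Z x" using x v(1) by (simp add: nbs_subset_eq[OF Z(2)])
  ultimately show ?thesis using x Z(2) unfolding cut_cover_def by fastforce
qed

lemma cut_cover_cross:
  assumes G: "simple_graph G" and bf: "biclique_free G d"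
    and XY: "X \<subseteq> verts G" "Y \<subseteq> verts G" "X \<inter> Y = {}" and v: "v \<in> Y" "v \<in> cut_cover G d X"
  shows "v \<in> cut_cover G d Y"
proof -
  have finV: "finite (verts G)" using G by (simp add: simple_graph_def)
  obtain x where x: "x \<in> X" "v \<in> nbs G X x" "d < card (twins G X x)"
    using v XY(3) by (auto simp: cut_cover_def)
  have tw: "twins G X x \<subseteq> nbs G Y v"
  proof
    fix w assume w: "w \<in> twins G X x"
    then have "v \<in> nbs G X w" "w \<in> X" using x(2) by (simp_all add: twins_def)
    then have "{v, w} \<in> edges G" "w \<in> verts G - Y" using XY by (auto simp: nbs_def insert_commute)
    then show "w \<in> nbs G Y v" by (simp add: nbs_def)
  qed
  have "finite (nbs G Y v)" using finV by (simp add: nbs_def)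
  then have "card (twins G X x) \<le> card (nbs G Y v)" using tw by (rule card_mono)
  then have big: "d < card (nbs G Y v)" using x(3) by linarith
  have "\<forall>a\<in>twins G Y v. \<forall>c\<in>nbs G Y v. {a, c} \<in> edges G"
    unfolding twins_def by (auto simp: nbs_def)
  moreover have "twins G Y v \<subseteq> verts G" "nbs G Y v \<subseteq> verts G"
    using XY by (auto simp: twins_def nbs_def)
  ultimately have "card (twins G Y v) \<le> d \<or> card (nbs G Y v) \<le> d"
    using bf unfolding biclique_free_def by blast
  then have "card (twins G Y v) \<le> d" using big by linarith
  moreover have "nbs G Y v \<noteq> {}" using big by auto
  ultimately show ?thesis using v(1) by (simp add: cut_cover_def)
qed

text \<open>A rooted tree decomposition of the part of \<open>G\<close> built so far. Bags may contain vertices outside \<open>X\<close>,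
but only those of the cover, all of which are present at the root \<open>rt\<close>. An edge that has an end in
\<open>X\<close> and does not lie in a bag yet has that end in the cover, hence at the root, where it can be
dealt with later.\<close>

definition partial_td ::
    "'a graph \<Rightarrow> nat \<Rightarrow> nat \<Rightarrow> 'a set \<Rightarrow> nat graph \<Rightarrow> (nat \<Rightarrow> 'a set) \<Rightarrow> nat \<Rightarrow> bool" where
  "partial_td G d b X T bag rt \<longleftrightarrow>
     is_tree T \<and> rt \<in> verts T \<and> cut_cover G d X \<subseteq> bag rt \<and>
     (\<forall>t\<in>verts T. bag t \<subseteq> verts G \<and> card (bag t) \<le> b) \<and>
     (\<forall>v\<in>X. \<exists>t\<in>verts T. v \<in> bag t) \<and>
     (\<forall>v. connected_on T {t. v \<in> bag t}) \<and>
     (\<forall>t\<in>verts T. bag t \<subseteq> X \<union> cut_cover G d X) \<and>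
     (\<forall>u\<in>X. \<forall>v. {u, v} \<in> edges G \<longrightarrow> u \<in> cut_cover G d X \<or> (\<exists>t\<in>verts T. {u, v} \<subseteq> bag t))"

text \<open>In a merge a new root is joined to the roots of the two parts; its bag is the union of the covers of
the two parts and of the whole. The bound \<open>n\<close> from below serves to keep the nodes of the parts and
the new root distinct.\<close>

lemma partial_td_exists:
  assumes G: "simple_graph G" and bf: "biclique_free G d" and md: "m \<ge> 1" "d \<ge> 1"
    and br: "branching (sparse_cut G m) X"
  shows "\<exists>T bag rt. partial_td G d (3 * (m * d)) X T bag rt \<and> verts T \<subseteq> {n..}"
  using br
proof (induction arbitrary: n)
  case (single v)
  have vV: "v \<in> verts G" using single by (simp add: sparse_cut_def)
  have le: "card (twins G {v} w) \<le> d" for w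
  proof -
    have "card (twins G {v} w) \<le> card {v}" by (rule card_mono) (auto simp: twins_def)
    then show ?thesis using md by simp
  qed
  have sub: "cut_cover G d {v} \<subseteq> {v}" using le by (auto simp: cut_cover_def linorder_not_less[symmetric])
  have "v \<in> cut_cover G d {v}" if "{v, w} \<in> edges G" for w
  proof -
    have "w \<in> nbs G {v} v" using simple_graph_edge[OF G that] that by (auto simp: nbs_def)
    then show ?thesis using le[of v] by (auto simp: cut_cover_def)
  qed
  then have "partial_td G d (3 * (m * d)) {v} (point n) (\<lambda>_. {v}) n"
    using sub vV md by (auto simp: partial_td_def tree_point connected_on_def)
  then show ?case by (intro exI[of _ "point n"] exI[of _ "\<lambda>_. {v}"] exI[of _ n]) simp
next
  case (merge X Y)
  let ?b = "3 * (m * d)" and ?Z = "X \<union> Y" and ?c = "cut_cover G d"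
  obtain S bagS s where S: "partial_td G d ?b X S bagS s" "verts S \<subseteq> {Suc n..}"
    using merge.IH(1)[of "Suc n"] by blast
  have "finite (verts S)" using S(1) by (simp add: partial_td_def is_tree_def simple_graph_def)
  then obtain k where k: "\<And>t. t \<in> verts S \<Longrightarrow> t < k"
    by (metis finite_nat_set_iff_bounded)
  obtain T bagT t where T: "partial_td G d ?b Y T bagT t" "verts T \<subseteq> {max k (Suc n)..}"
    using merge.IH(2)[of "max k (Suc n)"] by blast
  have dj: "verts S \<inter> verts T = {}" "n \<notin> verts S" "n \<notin> verts T" using S(2) T(2) k by fastforce+
  have sc: "sparse_cut G m X" "sparse_cut G m Y" "sparse_cut G m ?Z"
    using merge.hyps branching_holds by blast+
  have V: "X \<subseteq> verts G" "Y \<subseteq> verts G" using sc by (auto simp: sparse_cut_def)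
  have finZ: "finite ?Z" using V G by (meson finite_Un finite_subset simple_graph_def)
  define R where "R = ?c X \<union> ?c Y \<union> ?c ?Z"
  define bag where "bag x = (if x = n then R else if x \<in> verts S then bagS x else bagT x)" for x
  let ?J = "bridge_join (point n) n S s"
  let ?K = "bridge_join ?J n T t"
  have bag: "bag n = R" "\<And>x. x \<in> verts S \<Longrightarrow> bag x = bagS x" "\<And>x. x \<in> verts T \<Longrightarrow> bag x = bagT x"
    using dj by (auto simp: bag_def)
  have vJ: "verts ?J = insert n (verts S)" by (simp add: bridge_join_def)
  have vK: "verts ?K = insert n (verts S \<union> verts T)" by (simp add: bridge_join_def)
  have st: "s \<in> verts S" "t \<in> verts T" "?c X \<subseteq> bag s" "?c Y \<subseteq> bag t"
    using S(1) T(1) bag by (auto simp: partial_td_def)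
  have outS: "v \<in> X \<or> v \<in> ?c X" if "x \<in> verts S" "v \<in> bag x" for x v
    using S(1) that bag by (auto simp: partial_td_def)
  have outT: "v \<in> Y \<or> v \<in> ?c Y" if "x \<in> verts T" "v \<in> bag x" for x v
    using T(1) that bag by (auto simp: partial_td_def)
  have inX: "v \<in> ?c X" if "v \<in> X" "v \<in> R" for v
    using that cut_cover_shrink[OF finZ, of X v G d] cut_cover_cross[OF G bf V(2,1), of v] merge.hyps(3)
    by (auto simp: R_def)
  have inY: "v \<in> ?c Y" if "v \<in> Y" "v \<in> R" for v
    using that cut_cover_shrink[OF finZ, of Y v G d] cut_cover_cross[OF G bf V, of v] merge.hyps(3)
    by (auto simp: R_def)
  have growX: "v \<in> ?c ?Z" if "v \<notin> ?Z" "v \<in> ?c X" for v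
    using cut_cover_grow[OF finZ Un_upper1 that] .
  have growY: "v \<in> ?c ?Z" if "v \<notin> ?Z" "v \<in> ?c Y" for v
    using cut_cover_grow[OF finZ Un_upper2 that] .
  have tree: "is_tree ?K"
  proof (rule tree_bridge_join)
    show "is_tree ?J"
      by (rule tree_bridge_join) (use S(1) dj st in \<open>auto simp: tree_point partial_td_def\<close>)
  qed (use T(1) dj st vJ in \<open>auto simp: partial_td_def\<close>)
  have conn: "connected_on ?K {x. v \<in> bag x}" for v
  proof -
    let ?U = "{x. v \<in> bag x}"
    have "connected_on S {x. v \<in> bagS x}" using S(1) by (simp add: partial_td_def)
    then have cS: "connected_on S ?U"
      by (rule iffD1[OF connected_on_cong, rotated]) (use bag in auto)
    have "connected_on T {x. v \<in> bagT x}" using T(1) by (simp add: partial_td_def)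
    then have cT: "connected_on T ?U"
      by (rule iffD1[OF connected_on_cong, rotated]) (use bag in auto)
    have meetS: "s \<in> ?U" if "n \<in> ?U" "?U \<inter> verts S \<noteq> {}"
      using that outS inX bag(1) st(3) by blast
    have meetT: "t \<in> ?U" if "n \<in> ?U" "?U \<inter> verts T \<noteq> {}"
      using that outT inY bag(1) st(4) by blast
    have both: "n \<in> ?U" if "?U \<inter> verts S \<noteq> {}" "?U \<inter> verts T \<noteq> {}"
    proof -
      have "(v \<in> X \<or> v \<in> ?c X) \<and> (v \<in> Y \<or> v \<in> ?c Y)" using that outS outT by blast
      then show ?thesis using merge.hyps(3) bag(1) by (auto simp: R_def)
    qed
    have "connected_on ?J ?U"
      by (rule connected_on_bridge_join) (use cS meetS st in \<open>auto simp: connected_on_def[of "point n"]\<close>)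
    then show ?thesis
      by (rule connected_on_bridge_join) (use cT meetT both st vJ in auto)
  qed
  have RV: "R \<subseteq> verts G" unfolding R_def using V by (intro Un_least cut_cover_subset)
  have "card R \<le> ?b"
  proof -
    have "card R \<le> card (?c X) + card (?c Y) + card (?c ?Z)"
      unfolding R_def by (meson add_le_mono1 card_Un_le le_trans)
    moreover have "card (?c X) \<le> m * d" "card (?c Y) \<le> m * d" "card (?c ?Z) \<le> m * d"
      using card_cut_cover_le[OF G bf] sc by blast+
    ultimately show ?thesis by linarith
  qed
  then have bags: "bag x \<subseteq> verts G \<and> card (bag x) \<le> ?b" if "x \<in> verts ?K" for x
  proof -
    have "bagS x \<subseteq> verts G \<and> card (bagS x) \<le> ?b" if "x \<in> verts S"
      using S(1) that unfolding partial_td_def by blast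
    moreover have "bagT x \<subseteq> verts G \<and> card (bagT x) \<le> ?b" if "x \<in> verts T"
      using T(1) that unfolding partial_td_def by blast
    ultimately show ?thesis using that bag RV \<open>card R \<le> ?b\<close> unfolding vK by auto
  qed
  have covS: "\<forall>v\<in>X. \<exists>x\<in>verts S. v \<in> bagS x" using S(1) unfolding partial_td_def by (elim conjE)
  have covT: "\<forall>v\<in>Y. \<exists>x\<in>verts T. v \<in> bagT x" using T(1) unfolding partial_td_def by (elim conjE)
  have edgeS: "\<forall>u\<in>X. \<forall>v. {u, v} \<in> edges G \<longrightarrow> u \<in> ?c X \<or> (\<exists>x\<in>verts S. {u, v} \<subseteq> bagS x)"
    using S(1) unfolding partial_td_def by (elim conjE)
  have edgeT: "\<forall>u\<in>Y. \<forall>v. {u, v} \<in> edges G \<longrightarrow> u \<in> ?c Y \<or> (\<exists>x\<in>verts T. {u, v} \<subseteq> bagT x)"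
    using T(1) unfolding partial_td_def by (elim conjE)
  have verts: "\<exists>x\<in>verts ?K. v \<in> bag x" if v: "v \<in> ?Z" for v
  proof (cases "v \<in> X")
    case True
    then obtain x where "x \<in> verts S" "v \<in> bagS x" using covS by blast
    then show ?thesis using bag(2) vK by auto
  next
    case False
    then obtain x where "x \<in> verts T" "v \<in> bagT x" using covT v by blast
    then show ?thesis using bag(3) vK by auto
  qed
  have out: "bag x \<subseteq> ?Z \<union> ?c ?Z" if "x \<in> verts ?K" for x
  proof
    fix v assume "v \<in> bag x"
    moreover have "x = n \<or> x \<in> verts S \<or> x \<in> verts T" using that vK by simp
    ultimately have "v \<in> X \<or> v \<in> Y \<or> v \<in> ?c X \<or> v \<in> ?c Y \<or> v \<in> ?c ?Z"
      using outS[of x v] outT[of x v] bag(1) by (auto simp: R_def)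
    then show "v \<in> ?Z \<union> ?c ?Z" using growX growY by blast
  qed
  have edges: "u \<in> ?c ?Z \<or> (\<exists>x\<in>verts ?K. {u, v} \<subseteq> bag x)" if u: "u \<in> ?Z" and e: "{u, v} \<in> edges G" for u v
  proof (cases "\<exists>x\<in>verts ?K. {u, v} \<subseteq> bag x")
    case False
    \<comment> \<open>An end of an edge not yet in a bag is in the cover of its part, hence in the new bag.\<close>
    have inR: "w \<in> R" if w: "w \<in> ?Z" "{w, w'} = {u, v}" for w w'
    proof -
      have ww: "{w, w'} \<in> edges G" using w e by simp
      have no: "\<not> {w, w'} \<subseteq> bag x" if "x \<in> verts ?K" for x using False that unfolding w(2) by blast
      have noS: "\<not> {w, w'} \<subseteq> bagS x" if "x \<in> verts S" for x
        using no[of x] bag(2)[OF that] that vK by simp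
      have noT: "\<not> {w, w'} \<subseteq> bagT x" if "x \<in> verts T" for x
        using no[of x] bag(3)[OF that] that vK by simp
      have "w \<in> ?c X \<or> w \<in> ?c Y" using w(1) ww edgeS edgeT noS noT by blast
      then show ?thesis by (auto simp: R_def)
    qed
    have "u \<in> R" using inR[of u v] u by simp
    moreover have "\<not> {u, v} \<subseteq> R" using False bag(1) vK by auto
    ultimately have "v \<notin> R" by simp
    then have "v \<notin> ?Z" using inR[of v u] by (auto simp: insert_commute)
    then have "v \<in> verts G - ?Z" using simple_graph_edge[OF G e] by simp
    then show ?thesis using cut_cover_covers[OF e u, of d] \<open>v \<notin> R\<close> by (auto simp: R_def)
  qed blast
  have "partial_td G d ?b ?Z ?K bag n"
    unfolding partial_td_def
  proof (intro conjI ballI allI impI)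
    show "n \<in> verts ?K" using vK by simp
    show "?c ?Z \<subseteq> bag n" using bag(1) by (auto simp: R_def)
  qed (use tree bags verts conn out edges in \<open>blast+\<close>)
  moreover have "verts ?K \<subseteq> {n..}" unfolding vK using S(2) T(2) by fastforce
  ultimately show ?case by blast
qed

text \<open>No edge leaves the whole vertex set, so its cover is empty and nothing remains to be dealt with at
the root.\<close>

lemma treewidth_le_of_branching:
  assumes G: "simple_graph G" and bf: "biclique_free G d" and md: "m \<ge> 1" "d \<ge> 1"
    and br: "branching (sparse_cut G m) (verts G)"
  shows "treewidth G + 1 \<le> 3 * (m * d)"
proof -
  obtain T bag rt where p: "partial_td G d (3 * (m * d)) (verts G) T bag rt"
    using partial_td_exists[OF G bf md br, of 0] by blast
  have "nbs G (verts G) v = {}" for v by (simp add: nbs_def)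
  then have empty: "cut_cover G d (verts G) = {}" by (simp add: cut_cover_def)
  have tree: "is_tree T" and bags: "\<forall>t\<in>verts T. bag t \<subseteq> verts G \<and> card (bag t) \<le> 3 * (m * d)"
    and cov: "\<forall>v\<in>verts G. \<exists>t\<in>verts T. v \<in> bag t" and conn: "\<forall>v. connected_on T {t. v \<in> bag t}"
    and edg: "\<forall>u\<in>verts G. \<forall>v. {u, v} \<in> edges G \<longrightarrow>
      u \<in> cut_cover G d (verts G) \<or> (\<exists>t\<in>verts T. {u, v} \<subseteq> bag t)"
    and rt: "rt \<in> verts T"
    using p unfolding partial_td_def by - (elim conjE, assumption)+
  have "tree_decomposition G T bag"
    unfolding tree_decomposition_def
  proof (intro conjI ballI)
    show "(\<Union>t\<in>verts T. bag t) = verts G" using bags cov by blast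
    show "connected_graph (induced T {t. v \<in> bag t})" if "v \<in> verts G" for v
      unfolding connected_induced_iff using cov conn that by blast
    show "\<exists>t\<in>verts T. e \<subseteq> bag t" if e: "e \<in> edges G" for e
    proof -
      have "card e = 2" "e \<subseteq> verts G" using e G by (auto simp: simple_graph_def)
      then obtain u v where "e = {u, v}" "u \<in> verts G" by (auto simp: card_2_iff)
      then show ?thesis using edg e empty by auto
    qed
  qed (rule tree)
  then have "treewidth G \<le> td_width T bag"
    unfolding treewidth_def by (intro Least_le) blast
  moreover have "Max ((\<lambda>t. card (bag t)) ` verts T) \<le> 3 * (m * d)"
  proof (rule Max.boundedI)
    show "finite ((\<lambda>t. card (bag t)) ` verts T)"
      using tree by (simp add: is_tree_def simple_graph_def)
  qed (use bags rt in auto)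
  moreover have "3 * (m * d) \<ge> 1" using md by simp
  ultimately show ?thesis unfolding td_width_def by linarith
qed

section \<open>Rank-width against clique-width and tree-width\<close>

theorem theorem18:
  fixes G :: "'a graph" and r :: real
  assumes "simple_graph G"
    and "edges G \<noteq> {}"
    and "nabla 1 G \<le> r"
  shows "real (cliquewidth G) < 2 * 4 powr r * real (rankwidth G) \<and>
         real (treewidth G) + 1 < 12 * r * 4 powr r * real (rankwidth G)"
proof -
  note G = assms(1) and r = assms(3)
  let ?k = "rankwidth G" and ?d = "nat \<lfloor>2 * r\<rfloor>" and ?V = "verts G"
  obtain e where e: "e \<in> edges G" using assms(2) by blast
  then have "card e = 2" using G by (simp add: simple_graph_def)
  then obtain u v where uv: "u \<noteq> v" "{u, v} \<in> edges G" using e by (auto simp: card_2_iff)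
  have V: "u \<in> ?V" "v \<in> ?V" using simple_graph_edge[OF G uv(2)] by auto
  have finV: "finite ?V" using G by (simp add: simple_graph_def)
  have card: "card ?V \<ge> 2" using card_mono[of ?V "{u, v}"] finV V uv(1) by simp
  have bf: "biclique_free G ?d"
    unfolding biclique_free_def
  proof (intro allI impI)
    fix A C assume "A \<subseteq> ?V" "C \<subseteq> ?V" "\<forall>a\<in>A. \<forall>c\<in>C. {a, c} \<in> edges G"
    then show "card A \<le> ?d \<or> card C \<le> ?d" by (intro no_large_biclique[OF G r _ _ _ refl]) auto
  qed
  \<comment> \<open>A single edge is a complete bipartite graph, whence \<open>r \<ge> 1/2\<close>.\<close>
  have "card {u} \<le> ?d \<or> card {v} \<le> ?d"
    by (rule no_large_biclique[OF G r _ _ _ refl]) (use V uv in auto)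
  then have d: "?d \<ge> 1" by simp
  then have r_pos: "2 * r \<ge> 1" by linarith
  have dr: "real ?d \<le> 2 * r" using r_pos by simp
  have pow: "4 powr r \<ge> 2"
  proof -
    have "(4::real) powr (1/2) \<le> 4 powr r" using r_pos by (intro powr_mono) auto
    then show ?thesis by (simp add: powr_half_sqrt)
  qed
  have br: "branching (\<lambda>X. X \<subseteq> ?V \<and> cut_rank G X \<le> ?k) ?V" by (rule branching_of_rankwidth[OF G card])
  have "nbs G {u} u \<noteq> {}" using uv V by (auto simp: nbs_def)
  then have "1 \<le> cut_rank G {u}" by (intro cut_rank_pos[of "{u}" u]) auto
  also have "\<dots> \<le> ?k" using branching_singleton[OF br V(1)] by simp
  finally have k: "1 \<le> ?k" .
  define m where "m = nat \<lfloor>4 powr r * (real ?k - 1) + 1\<rfloor>"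
  have nonneg: "0 \<le> 4 powr r * (real ?k - 1)" using k by simp
  have m1: "m \<ge> 1" and m: "real m \<le> 4 powr r * (real ?k - 1) + 1"
    using nonneg unfolding m_def by linarith+
  have sparse: "branching (sparse_cut G m) ?V"
  proof (rule branching_mono[OF br])
    fix X assume X: "X \<subseteq> ?V \<and> cut_rank G X \<le> ?k"
    then have "real (card (nbs G X ` X - {{}})) \<le> 4 powr r * (real ?k - 1) + 1"
      using card_nbs_le[OF G r _ _ k] by blast
    then show "sparse_cut G m X" using X unfolding sparse_cut_def m_def by linarith
  qed
  \<comment> \<open>Since \<open>4 powr r \<ge> 2\<close>, the left-hand side is at most \<open>2 * 4 powr r * k - 1\<close>.\<close>
  have key: "2 * real m + 1 < 2 * 4 powr r * real ?k"
    using m pow by (simp add: algebra_simps)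
  obtain t where t: "k_expr (2 * m + 1) t" "expr_verts t = ?V" "expr_edges t = {e \<in> edges G. e \<subseteq> ?V}"
    using expression_of_branching[OF G m1 sparse] by blast
  moreover have "{e \<in> edges G. e \<subseteq> ?V} = edges G" using G by (auto simp: simple_graph_def)
  ultimately have "cliquewidth G \<le> 2 * m + 1"
    unfolding cliquewidth_def by (intro Least_le) auto
  then have cw: "real (cliquewidth G) \<le> 2 * real m + 1" by linarith
  have "treewidth G + 1 \<le> 3 * (m * ?d)" by (rule treewidth_le_of_branching[OF G bf m1 d sparse])
  then have "real (treewidth G + 1) \<le> real (3 * (m * ?d))" by (simp only: of_nat_le_iff)
  then have "real (treewidth G) + 1 \<le> 3 * real m * real ?d" by simp
  also have "\<dots> \<le> 3 * real m * (2 * r)" by (rule mult_left_mono[OF dr]) simp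
  also have "\<dots> = 3 * r * (2 * real m)" by simp
  also have "\<dots> < 3 * r * (2 * 4 powr r * real ?k)"
    using key r_pos by (intro mult_strict_left_mono) auto
  also have "\<dots> = 6 * r * 4 powr r * real ?k" by simp
  also have "\<dots> \<le> 12 * r * 4 powr r * real ?k" using r_pos by (intro mult_right_mono) auto
  finally show ?thesis using cw key by linarith
qed

end
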